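(* Let $d\in\mathbb N$, $d\ge 1$, let $\alpha>0$ and $\beta\ge 0$, and let $H$ be a linear operator on $\ell^2(\mathbb Z^d)$ exhibiting $(\alpha,\beta)$-Power-Law SULE, with associated orthonormal basis of eigenfunctions $\{\varphi_m\}_{m\in\mathbb Z^d}$ and localization centers $\{j_m\}_{m\in\mathbb Z^d}\subset\mathbb Z^d$. Then the following hold. (i) Assume that $\alpha>\beta+\frac d2$. (a) For every $L\ge 1$ the set $\{m\in\mathbb Z^d:\langle j_m\rangle\le L\}$ is finite, and $$\limsup_{L\to\infty}\frac{\#\{m:\langle j_m\rangle\le L\}}{(2L+1)^d}\le 1 .$$ (b) For every $\varepsilon>0$ there exists a constant $\gamma_{\alpha,\beta,\varepsilon}>0$ such that, for all $k,n\in\mathbb Z^d$, $$\sum_{m\in\mathbb Z^d}|\varphi_m(k)|\,|\varphi_m(n)|\le \gamma_{\alpha,\beta,\varepsilon}\,\frac{\min\{\langle k\rangle,\langle n\rangle\}^{\beta+\frac d2+\varepsilon}}{\langle n-k\rangle^{\alpha-\beta-\frac d2-\varepsilon}} .$$ (c) If, in addition, $H$ is self-adjoint and $\alpha>\beta+d$, then for every $k\in\mathbb Z^d$ and every $0<q<2\alpha-2\beta-2d$, $$\sup_{t\in\mathbb R}\sum_{n\in\mathbb Z^d}\langle n\rangle^q\left|\langle e^{-itH}\delta_k,\delta_n\rangle\right|^2<\infty .$$ (ii) Assume that $\alpha>\beta+d$. Then $$\lim_{L\to\infty}\frac{\#\{m:\langle j_m\rangle\le L\}}{(2L+1)^d}=1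 .$$
   Context: For $n\in\mathbb Z^d$, $\|n\|:=\max_{1\le i\le d}|n_i|$ and $\langle n\rangle:=\|n\|+1$. $\{\delta_n\}_{n\in\mathbb Z^d}$ is the canonical basis of $\ell^2(\mathbb Z^d)$; $\langle u,v\rangle$ with two arguments in $\ell^2(\mathbb Z^d)$ denotes the inner product. Definition. Let $\alpha>0$, $\beta\ge0$. A linear operator $H$ on $\ell^2(\mathbb Z^d)$ exhibits $(\alpha,\beta)$-Power-Law SULE if there exist an orthonormal basis $\{\varphi_m\}_{m\in\mathbb Z^d}$ of $\ell^2(\mathbb Z^d)$ consisting of eigenfunctions of $H$ and, for each $m\in\mathbb Z^d$, a localization center $j_m\in\mathbb Z^d$, such that $$|\varphi_m(n)|\le C_{\alpha,\beta}\,\frac{\langle j_m\rangle^\beta}{\langle n-j_m\rangle^\alpha}\quad\text{for all } n\in\mathbb Z^d,$$ where the constant $C_{\alpha,\beta}$ does not depend on $m$ or $n$. The localization centers need not be distinct. *)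

theory Defs
  imports "HOL-Analysis.Analysis"
begin

section \<open>The Hilbert space of square-summable families\<close>

typedef 'a ell2 = "{f :: 'a \<Rightarrow> complex. (\<lambda>x. (cmod (f x))\<^sup>2) summable_on UNIV}"
  morphisms coord Abs_ell2
  by (rule exI[of _ "\<lambda>_. 0"]) simp

setup_lifting type_definition_ell2

lemma summable_coord: "(\<lambda>x. (cmod (coord u x))\<^sup>2) summable_on UNIV"
  using coord[of u] by simp

lemma ell2_eqI: "(\<And>x. coord u x = coord v x) \<Longrightarrow> u = v"
  by (metis coord_inject ext)

lemma square_summable_add:
  fixes f g :: "'a \<Rightarrow> complex"
  assumes "(\<lambda>x. (cmod (f x))\<^sup>2) summable_on UNIV" "(\<lambda>x. (cmod (g x))\<^sup>2) summable_on UNIV"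
  shows "(\<lambda>x. (cmod (f x + g x))\<^sup>2) summable_on UNIV"
proof (rule summable_on_comparison_test)
  show "(\<lambda>x. 2 * (cmod (f x))\<^sup>2 + 2 * (cmod (g x))\<^sup>2) summable_on UNIV"
    using assms by (intro summable_on_add summable_on_cmult_right)
  fix x
  have "(cmod (f x + g x))\<^sup>2 \<le> (cmod (f x) + cmod (g x))\<^sup>2"
    by (intro power_mono norm_triangle_ineq norm_ge_zero)
  also have "\<dots> \<le> 2 * (cmod (f x))\<^sup>2 + 2 * (cmod (g x))\<^sup>2"
    using zero_le_power2[of "cmod (f x) - cmod (g x)"]
    by (simp add: power2_eq_square algebra_simps)
  finally show "(cmod (f x + g x))\<^sup>2 \<le> 2 * (cmod (f x))\<^sup>2 + 2 * (cmod (g x))\<^sup>2" .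
qed simp

lemma square_summable_scale:
  fixes f :: "'a \<Rightarrow> complex"
  assumes "(\<lambda>x. (cmod (f x))\<^sup>2) summable_on UNIV"
  shows "(\<lambda>x. (cmod (c * f x))\<^sup>2) summable_on UNIV"
  using summable_on_cmult_right[OF assms, of "(cmod c)\<^sup>2"]
  by (simp add: norm_mult power_mult_distrib)

lift_definition scaleC :: "complex \<Rightarrow> 'a ell2 \<Rightarrow> 'a ell2"  (infixr \<open>*\<^sub>C\<close> 75)
  is "\<lambda>c f x. c * f x"
  by (rule square_summable_scale)

text \<open>The inner product is linear in the first argument.\<close>

definition cinner :: "'a ell2 \<Rightarrow> 'a ell2 \<Rightarrow> complex" where
  "cinner u v = (\<Sum>\<^sub>\<infinity>x. coord u x * cnj (coord v x))"

lift_definition delta :: "'a \<Rightarrow> 'a ell2" is "\<lambda>k x. if x = k then 1 else 0"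
proof -
  fix k :: 'a
  have "(\<lambda>x. (cmod (if x = k then 1 else 0))\<^sup>2) summable_on {k}" by simp
  then show "(\<lambda>x. (cmod (if x = k then 1 else 0))\<^sup>2) summable_on UNIV"
    by (rule summable_on_cong_neutral[THEN iffD1, rotated -1]) auto
qed

lemma summable_cinner: "(\<lambda>x. coord u x * cnj (coord v x)) summable_on UNIV"
proof (rule abs_summable_summable)
  show "(\<lambda>x. norm (coord u x * cnj (coord v x))) summable_on UNIV"
  proof (rule summable_on_comparison_test)
    show "(\<lambda>x. (cmod (coord u x))\<^sup>2 + (cmod (coord v x))\<^sup>2) summable_on UNIV"
      by (intro summable_on_add summable_coord)
    fix x
    have "0 \<le> cmod (coord u x) * cmod (coord v x)" by simp
    then have "cmod (coord u x) * cmod (coord v x) \<le> (cmod (coord u x))\<^sup>2 + (cmod (coord v x))\<^sup>2"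
      using zero_le_power2[of "cmod (coord u x) - cmod (coord v x)"]
      unfolding power2_diff by linarith
    then show "norm (coord u x * cnj (coord v x)) \<le> (cmod (coord u x))\<^sup>2 + (cmod (coord v x))\<^sup>2"
      by (simp add: norm_mult)
  qed simp
qed

instantiation ell2 :: (type) real_inner
begin

lift_definition zero_ell2 :: "'a ell2" is "\<lambda>_. 0" by simp
lift_definition plus_ell2 :: "'a ell2 \<Rightarrow> 'a ell2 \<Rightarrow> 'a ell2" is "\<lambda>f g x. f x + g x"
  by (rule square_summable_add)
lift_definition uminus_ell2 :: "'a ell2 \<Rightarrow> 'a ell2" is "\<lambda>f x. - f x" by simp
lift_definition minus_ell2 :: "'a ell2 \<Rightarrow> 'a ell2 \<Rightarrow> 'a ell2" is "\<lambda>f g x. f x - g x"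
  using square_summable_add[where g = "\<lambda>x. - g x" for g] by simp

definition scaleR_ell2 :: "real \<Rightarrow> 'a ell2 \<Rightarrow> 'a ell2" where
  "scaleR_ell2 r u = complex_of_real r *\<^sub>C u"
definition inner_ell2 :: "'a ell2 \<Rightarrow> 'a ell2 \<Rightarrow> real" where
  "inner_ell2 u v = Re (cinner u v)"
definition norm_ell2 :: "'a ell2 \<Rightarrow> real" where
  "norm_ell2 u = sqrt (inner u u)"
definition sgn_ell2 :: "'a ell2 \<Rightarrow> 'a ell2" where
  "sgn_ell2 u = scaleR (inverse (norm u)) u"
definition dist_ell2 :: "'a ell2 \<Rightarrow> 'a ell2 \<Rightarrow> real" where
  "dist_ell2 u v = norm (u - v)"
definition uniformity_ell2 :: "('a ell2 \<times> 'a ell2) filter" where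
  "uniformity_ell2 = (INF e\<in>{0<..}. principal {(u, v). dist u v < e})"
definition open_ell2 :: "'a ell2 set \<Rightarrow> bool" where
  "open_ell2 U = (\<forall>u\<in>U. eventually (\<lambda>(u', v). u' = u \<longrightarrow> v \<in> U) uniformity)"

lemma cinner_self: "cinner u u = complex_of_real (\<Sum>\<^sub>\<infinity>x. (cmod (coord u x))\<^sup>2)"
proof -
  have "((\<lambda>x. complex_of_real ((cmod (coord u x))\<^sup>2)) has_sum
          complex_of_real (\<Sum>\<^sub>\<infinity>x. (cmod (coord u x))\<^sup>2)) UNIV"
    by (intro has_sum_of_real has_sum_infsum summable_coord)
  then show ?thesis
    unfolding cinner_def complex_norm_square by (rule infsumI)
qed

instance
proof
  fix u v w :: "'a ell2" and a b r :: real
  show "u + v + w = u + (v + w)" by transfer (simp add: add.assoc)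
  show "u + v = v + u" by transfer (simp add: add.commute)
  show "0 + u = u" by transfer simp
  show "- u + u = 0" by transfer simp
  show "u - v = u + - v" by transfer simp
  show "a *\<^sub>R (u + v) = a *\<^sub>R u + a *\<^sub>R v"
    unfolding scaleR_ell2_def by transfer (simp add: algebra_simps)
  show "(a + b) *\<^sub>R u = a *\<^sub>R u + b *\<^sub>R u"
    unfolding scaleR_ell2_def by transfer (simp add: algebra_simps)
  show "a *\<^sub>R b *\<^sub>R u = (a * b) *\<^sub>R u"
    unfolding scaleR_ell2_def by transfer (simp add: algebra_simps)
  show "1 *\<^sub>R u = u" unfolding scaleR_ell2_def by transfer simp
  show "sgn u = scaleR (inverse (norm u)) u" by (rule sgn_ell2_def)
  show "dist u v = norm (u - v)" by (rule dist_ell2_def)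
  show "uniformity = (INF e\<in>{0<..}. principal {(u::'a ell2, v). dist u v < e})"
    by (rule uniformity_ell2_def)
  show "open U \<longleftrightarrow> (\<forall>u\<in>U. \<forall>\<^sub>F (u', v) in uniformity. u' = u \<longrightarrow> v \<in> U)" for U :: "'a ell2 set"
    by (rule open_ell2_def)
  show "norm u = sqrt (inner u u)" by (rule norm_ell2_def)
  have "cinner u v = cnj (cinner v u)"
    unfolding cinner_def infsum_cnj[symmetric] by (simp add: mult.commute)
  then show "inner u v = inner v u" by (simp add: inner_ell2_def)
  have "cinner (u + v) w = cinner u w + cinner v w"
    unfolding cinner_def infsum_add[OF summable_cinner summable_cinner, symmetric]
    by (simp add: plus_ell2.rep_eq algebra_simps)
  then show "inner (u + v) w = inner u w + inner v w" by (simp add: inner_ell2_def)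
  have "cinner (complex_of_real r *\<^sub>C u) v = complex_of_real r * cinner u v"
    unfolding cinner_def infsum_cmult_right'[symmetric]
    by (simp add: scaleC.rep_eq algebra_simps)
  then show "inner (r *\<^sub>R u) v = r * inner u v"
    by (simp add: inner_ell2_def scaleR_ell2_def)
  show "0 \<le> inner u u"
    by (simp add: inner_ell2_def cinner_self infsum_nonneg)
  show "inner u u = 0 \<longleftrightarrow> u = 0"
  proof
    assume "inner u u = 0"
    then have "(\<Sum>\<^sub>\<infinity>x. (cmod (coord u x))\<^sup>2) = 0"
      by (simp add: inner_ell2_def cinner_self)
    then have "(cmod (coord u x))\<^sup>2 = 0" for x
      using nonneg_infsum_le_0D[OF _ summable_coord[of u], of x] by simp
    then show "u = 0" by (intro ell2_eqI) (simp add: zero_ell2.rep_eq)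
  next
    assume "u = 0"
    then show "inner u u = 0" by (simp add: inner_ell2_def cinner_def zero_ell2.rep_eq)
  qed
qed

end

text \<open>This interpretation makes complex subspaces and complex spans available as
  \<open>ell2.subspace\<close> and \<open>ell2.span\<close>; the unqualified library constants are the real ones.\<close>

interpretation ell2: vector_space "scaleC :: complex \<Rightarrow> 'a ell2 \<Rightarrow> 'a ell2"
  by unfold_locales (transfer; simp add: algebra_simps)+

definition orthonormal_basis :: "('i \<Rightarrow> 'a ell2) \<Rightarrow> bool" where
  "orthonormal_basis \<phi> \<longleftrightarrow>
     (\<forall>m m'. cinner (\<phi> m) (\<phi> m') = (if m = m' then 1 else 0)) \<and>
     closure (ell2.span (range \<phi>)) = UNIV"


section \<open>Linear operators\<close>

text \<open>Operators may be unbounded: an operator is given by its domain \<open>D\<close> and a function \<open>H\<close>,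
  whose values outside \<open>D\<close> are irrelevant. Everywhere defined operators have \<open>D = UNIV\<close>.\<close>

definition linear_operator :: "'a ell2 set \<Rightarrow> ('a ell2 \<Rightarrow> 'a ell2) \<Rightarrow> bool" where
  "linear_operator D H \<longleftrightarrow>
     ell2.subspace D \<and>
     (\<forall>u\<in>D. \<forall>v\<in>D. H (u + v) = H u + H v) \<and>
     (\<forall>c. \<forall>u\<in>D. H (c *\<^sub>C u) = c *\<^sub>C H u)"

definition eigenfunction :: "'a ell2 set \<Rightarrow> ('a ell2 \<Rightarrow> 'a ell2) \<Rightarrow> 'a ell2 \<Rightarrow> bool" where
  "eigenfunction D H u \<longleftrightarrow> u \<in> D \<and> u \<noteq> 0 \<and> (\<exists>l. H u = l *\<^sub>C u)"

definition operator_graph :: "'a ell2 set \<Rightarrow> ('a ell2 \<Rightarrow> 'a ell2) \<Rightarrow> ('a ell2 \<times> 'a ell2) set" where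
  "operator_graph D H = {(u, H u) | u. u \<in> D}"

definition adjoint_graph :: "'a ell2 set \<Rightarrow> ('a ell2 \<Rightarrow> 'a ell2) \<Rightarrow> ('a ell2 \<times> 'a ell2) set" where
  "adjoint_graph D H = {(v, w). \<forall>u\<in>D. cinner (H u) v = cinner u w}"

definition self_adjoint :: "'a ell2 set \<Rightarrow> ('a ell2 \<Rightarrow> 'a ell2) \<Rightarrow> bool" where
  "self_adjoint D H \<longleftrightarrow>
     linear_operator D H \<and> closure D = UNIV \<and> adjoint_graph D H = operator_graph D H"

definition unitary :: "('a ell2 \<Rightarrow> 'a ell2) \<Rightarrow> bool" where
  "unitary U \<longleftrightarrow>
     linear_operator UNIV U \<and> surj U \<and> (\<forall>u v. cinner (U u) (U v) = cinner u v)"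

definition unitary_group :: "(real \<Rightarrow> 'a ell2 \<Rightarrow> 'a ell2) \<Rightarrow> bool" where
  "unitary_group U \<longleftrightarrow>
     (\<forall>t. unitary (U t)) \<and> U 0 = id \<and> (\<forall>s t. U (s + t) = U s \<circ> U t) \<and>
     (\<forall>u. continuous_on UNIV (\<lambda>t. U t u))"

text \<open>The propagator \<open>e\<^sup>-\<^sup>i\<^sup>t\<^sup>H\<close> of a self-adjoint operator, in the sense of Stone's theorem:
  the strongly continuous one-parameter unitary group whose generator is exactly \<open>-iH\<close>,
  with domain \<open>D\<close>.\<close>

definition propagator :: "'a ell2 set \<Rightarrow> ('a ell2 \<Rightarrow> 'a ell2) \<Rightarrow> real \<Rightarrow> 'a ell2 \<Rightarrow> 'a ell2" where
  "propagator D H = (THE U. unitary_group U \<and>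
     {(u, v). ((\<lambda>t. U t u) has_vector_derivative (- \<i>) *\<^sub>C v) (at 0)} = operator_graph D H)"


section \<open>Power-law SULE\<close>

definition supnorm :: "int ^ 'd \<Rightarrow> int" where
  "supnorm n = Max (range (\<lambda>i. \<bar>n $ i\<bar>))"

definition bracket :: "int ^ 'd \<Rightarrow> real" where
  "bracket n = real_of_int (supnorm n) + 1"

definition power_law_SULE_with ::
  "real \<Rightarrow> real \<Rightarrow> (int ^ 'd) ell2 set \<Rightarrow> ((int ^ 'd) ell2 \<Rightarrow> (int ^ 'd) ell2) \<Rightarrow>
   (int ^ 'd \<Rightarrow> (int ^ 'd) ell2) \<Rightarrow> (int ^ 'd \<Rightarrow> int ^ 'd) \<Rightarrow> bool" where
  "power_law_SULE_with \<alpha> \<beta> D H \<phi> j \<longleftrightarrow>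
     orthonormal_basis \<phi> \<and> (\<forall>m. eigenfunction D H (\<phi> m)) \<and>
     (\<exists>C. \<forall>m n. cmod (coord (\<phi> m) n) \<le>
                  C * (bracket (j m) powr \<beta> / bracket (n - j m) powr \<alpha>))"

text \<open>An operator \<open>(D, H)\<close> exhibits power-law SULE if \<open>power_law_SULE_with \<alpha> \<beta> D H \<phi> j\<close>
  holds for some \<open>\<phi>\<close> and \<open>j\<close>.\<close>

end

theory Submission
  imports Defs
begin

text \<open>
  Parseval's identity in the eigenbasis and at the lattice sites makes
  \<open>\<bar>\<phi>\<^sub>m(n)\<bar>\<^sup>2\<close> doubly stochastic. If \<open>\<langle>j\<^sub>m\<rangle> \<le> L\<close>, then \<open>\<phi>\<^sub>m\<close> has all but \<open>O(L\<^sup>-\<^sup>\<kappa>)\<close> of its mass in the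
  box of size \<open>(1 + \<eta>) L\<close>, and comparing with the number of sites in that box bounds the number
  of such \<open>m\<close> from above. Hence \<open>\<Sum>\<^sub>m \<langle>j\<^sub>m\<rangle>\<^sup>-\<^sup>s\<close> converges for \<open>s > d\<close>; therefore a site in the box of size
  \<open>(1 - \<eta>) L\<close> sees only \<open>O(L\<^sup>-\<^sup>\<kappa>)\<close> of its mass from the \<open>m\<close> with \<open>\<langle>j\<^sub>m\<rangle> > L\<close>, which gives the lower
  bound.

  For the correlator, put \<open>x\<^sub>m = max \<langle>k - j\<^sub>m\<rangle> \<langle>n - j\<^sub>m\<rangle>\<close>. Then \<open>\<langle>n - k\<rangle> \<le> 2 x\<^sub>m\<close> and
  \<open>\<langle>j\<^sub>m\<rangle> \<le> min \<langle>k\<rangle> \<langle>n\<rangle> x\<^sub>m\<close>, so the smaller of \<open>\<bar>\<phi>\<^sub>m(k)\<bar>\<close> and \<open>\<bar>\<phi>\<^sub>m(n)\<bar>\<close> is controlled by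
  \<open>\<langle>j\<^sub>m\<rangle> powr \<beta> / x\<^sub>m powr \<alpha>\<close>, and the other one is square summable over \<open>m\<close>.

  For the dynamics, the eigenbasis identifies a self-adjoint \<open>H\<close> with the maximal multiplication
  operator by its eigenvalues, so the propagator multiplies the coefficients by phases and its
  matrix elements are bounded by the correlator.
\<close>

section \<open>Orthonormal bases of the sequence space\<close>

lemma cinner_add_left: "cinner (u + v) w = cinner u w + cinner v w"
  unfolding cinner_def infsum_add[OF summable_cinner summable_cinner, symmetric]
  by (simp add: plus_ell2.rep_eq algebra_simps)

lemma cinner_scaleC_left: "cinner (c *\<^sub>C u) v = c * cinner u v"
  unfolding cinner_def infsum_cmult_right'[symmetric]
  by (simp add: scaleC.rep_eq algebra_simps)

lemma cinner_commute: "cinner u v = cnj (cinner v u)"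
  unfolding cinner_def infsum_cnj[symmetric] by (simp add: mult.commute)

lemma cinner_add_right: "cinner u (v + w) = cinner u v + cinner u w"
  by (subst (1 2 3) cinner_commute) (simp add: cinner_add_left)

lemma cinner_scaleC_right: "cinner u (c *\<^sub>C v) = cnj c * cinner u v"
  by (subst (1 2) cinner_commute) (simp add: cinner_scaleC_left)

lemma cinner_zero_left [simp]: "cinner 0 v = 0"
  and cinner_zero_right [simp]: "cinner v 0 = 0"
  by (simp_all add: cinner_def zero_ell2.rep_eq)

lemma cinner_sum_left: "cinner (\<Sum>i\<in>I. f i) v = (\<Sum>i\<in>I. cinner (f i) v)"
  by (induction I rule: infinite_finite_induct) (simp_all add: cinner_add_left)

lemma cinner_sum_right: "cinner v (\<Sum>i\<in>I. f i) = (\<Sum>i\<in>I. cinner v (f i))"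
  by (induction I rule: infinite_finite_induct) (simp_all add: cinner_add_right)

lemma coord_scaleR: "coord (r *\<^sub>R u) x = complex_of_real r * coord u x"
  by (simp add: scaleR_ell2_def scaleC.rep_eq)

lemma coord_sum: "coord (\<Sum>i\<in>I. f i) x = (\<Sum>i\<in>I. coord (f i) x)"
  by (induction I rule: infinite_finite_induct) (simp_all add: plus_ell2.rep_eq zero_ell2.rep_eq)

lemma cinner_delta_right [simp]: "cinner u (delta k) = coord u k"
proof -
  have "cinner u (delta k) = (\<Sum>\<^sub>\<infinity>x\<in>{k}. coord u x)"
    unfolding cinner_def by (rule infsum_cong_neutral) (auto simp: delta.rep_eq)
  then show ?thesis by simp
qed

lemma cinner_delta_left [simp]: "cinner (delta k) u = cnj (coord u k)"
  by (subst cinner_commute) simp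

lemma norm_ell2_sq: "(norm u)\<^sup>2 = (\<Sum>\<^sub>\<infinity>x. (cmod (coord u x))\<^sup>2)"
  by (simp add: power2_norm_eq_inner inner_ell2_def cinner_self)

lemma has_sum_norm_ell2: "((\<lambda>x. (cmod (coord u x))\<^sup>2) has_sum (norm u)\<^sup>2) UNIV"
  unfolding norm_ell2_sq by (intro has_sum_infsum summable_coord)

lemma sum_coord_le_norm: "finite F \<Longrightarrow> (\<Sum>x\<in>F. (cmod (coord u x))\<^sup>2) \<le> (norm u)\<^sup>2"
  unfolding norm_ell2_sq by (intro finite_sum_le_infsum summable_coord) auto

lemma cmod_coord_le_norm: "cmod (coord u x) \<le> norm u"
  using sum_coord_le_norm[of "{x}" u] by (simp add: power2_le_iff_abs_le)

lemma bounded_linear_coord: "bounded_linear (\<lambda>u. coord u x)"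
  by (rule bounded_linear_intro[where K = 1])
    (simp_all add: plus_ell2.rep_eq coord_scaleR scaleR_conv_of_real cmod_coord_le_norm)

text \<open>A uniform bound on finite partial sums is the form in which Bessel's inequality supplies
  square-summability.\<close>

lemma coord_Abs_ell2:
  assumes "\<And>F. finite F \<Longrightarrow> (\<Sum>x\<in>F. (cmod (f x))\<^sup>2) \<le> B"
  shows "coord (Abs_ell2 f) = f"
proof (rule Abs_ell2_inverse, clarify)
  show "(\<lambda>x. (cmod (f x))\<^sup>2) summable_on UNIV"
    by (rule nonneg_bdd_above_summable_on) (auto intro!: bdd_aboveI[of _ B] assms)
qed

lemma norm_le_ell2I:
  assumes "\<And>F. finite F \<Longrightarrow> (\<Sum>x\<in>F. (cmod (coord u x))\<^sup>2) \<le> B\<^sup>2" "B \<ge> 0"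
  shows "norm u \<le> B"
proof -
  have "(norm u)\<^sup>2 \<le> B\<^sup>2"
    unfolding norm_ell2_sq by (rule infsum_le_finite_sums[OF summable_coord]) (auto intro: assms)
  then show ?thesis using assms(2) by (simp add: power2_le_iff_abs_le)
qed

text \<open>Outside a suitable finite set the dominating vector has squared mass below
  \<open>e\<^sup>2 / 2\<close>, and on that set coordinatewise convergence suffices. Density of the
  finitely supported vectors and strong continuity and differentiability of the phase groups all
  rest on this.\<close>

lemma dominated_convergence_ell2:
  fixes F :: "'t \<Rightarrow> 'a ell2"
  assumes lim: "\<And>x. ((\<lambda>t. coord (F t) x) \<longlongrightarrow> 0) G"
    and dom: "\<And>t x. cmod (coord (F t) x) \<le> cmod (coord b x)"
  shows "(F \<longlongrightarrow> 0) G"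
proof (rule tendstoI)
  fix e :: real assume e: "e > 0"
  let ?b = "\<lambda>x. (cmod (coord b x))\<^sup>2"
  have "(sum ?b \<longlongrightarrow> infsum ?b UNIV) (finite_subsets_at_top UNIV)"
    by (intro infsum_tendsto summable_coord)
  then have "\<forall>\<^sub>F X in finite_subsets_at_top UNIV. dist (sum ?b X) (infsum ?b UNIV) < e\<^sup>2 / 2"
    using e by (intro tendstoD) auto
  then obtain X where X: "finite X" "dist (sum ?b X) (infsum ?b UNIV) < e\<^sup>2 / 2"
    by (auto simp: eventually_finite_subsets_at_top)
  have sub: "f summable_on - X" if "f summable_on UNIV" for f :: "'a \<Rightarrow> real"
    using that summable_on_subset_banach by blast
  have split: "infsum f UNIV = sum f X + infsum f (- X)" if "f summable_on UNIV" for f :: "'a \<Rightarrow> real"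
    using infsum_Un_disjoint[of f X "- X"] that X(1) sub[OF that] by (simp add: Compl_partition)
  have tail: "infsum ?b (- X) < e\<^sup>2 / 2"
    using X(2) split[OF summable_coord[of b]] by (simp add: dist_real_def)
  have "((\<lambda>t. \<Sum>x\<in>X. (cmod (coord (F t) x))\<^sup>2) \<longlongrightarrow> (\<Sum>x\<in>X. (cmod 0)\<^sup>2)) G"
    by (intro tendsto_sum tendsto_power tendsto_norm lim)
  then have "\<forall>\<^sub>F t in G. (\<Sum>x\<in>X. (cmod (coord (F t) x))\<^sup>2) < e\<^sup>2 / 2"
    using e by (intro order_tendstoD) auto
  then show "\<forall>\<^sub>F t in G. dist (F t) 0 < e"
  proof eventually_elim
    case (elim t)
    have "infsum (\<lambda>x. (cmod (coord (F t) x))\<^sup>2) (- X) \<le> infsum ?b (- X)"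
      by (intro infsum_mono sub summable_coord power_mono dom) auto
    then have "(norm (F t))\<^sup>2 < e\<^sup>2"
      unfolding norm_ell2_sq split[OF summable_coord] using elim tail by linarith
    then show ?case using e by (simp add: power2_less_imp_less)
  qed
qed

lemma closure_span_delta: "closure (ell2.span (range (delta :: 'a \<Rightarrow> 'a ell2))) = UNIV"
proof -
  have "u \<in> closure (ell2.span (range delta))" for u :: "'a ell2"
  proof -
    define P where "P X = (\<Sum>x\<in>X. coord u x *\<^sub>C delta x)" for X
    have coordP: "coord (P X) y = (if y \<in> X then coord u y else 0)" if "finite X" for X y
      using that by (simp add: P_def coord_sum scaleC.rep_eq delta.rep_eq if_distrib cong: if_cong)
    \<comment> \<open>Domination is required at every index, while \<open>coordP\<close> covers
      finite sets only; hence the default 0 at infinite sets, which eventually disappears along the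
      filter.\<close>
    have "((\<lambda>X. if finite X then P X - u else 0) \<longlongrightarrow> 0) (finite_subsets_at_top UNIV)"
    proof (rule dominated_convergence_ell2)
      fix x
      have "\<forall>\<^sub>F X in finite_subsets_at_top UNIV. coord (if finite X then P X - u else 0) x = 0"
        unfolding eventually_finite_subsets_at_top
        by (rule exI[of _ "{x}"]) (auto simp: minus_ell2.rep_eq coordP zero_ell2.rep_eq)
      then show "((\<lambda>X. coord (if finite X then P X - u else 0) x) \<longlongrightarrow> 0) (finite_subsets_at_top UNIV)"
        by (rule tendsto_eventually)
      show "cmod (coord (if finite X then P X - u else 0) x) \<le> cmod (coord u x)" for X
        by (auto simp: minus_ell2.rep_eq coordP zero_ell2.rep_eq)
    qed
    moreover have "\<forall>\<^sub>F X in finite_subsets_at_top UNIV. (if finite X then P X - u else 0) = P X - u"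
      by (rule eventually_mono[OF eventually_finite_subsets_at_top_weakI[of _ finite]]) auto
    ultimately have "((\<lambda>X. P X - u) \<longlongrightarrow> 0) (finite_subsets_at_top UNIV)"
      by (rule Lim_transform_eventually)
    then have "(P \<longlongrightarrow> u) (finite_subsets_at_top UNIV)" by (simp add: LIM_zero_iff)
    moreover have "P X \<in> ell2.span (range delta)" for X
      unfolding P_def by (intro ell2.span_sum ell2.span_scale ell2.span_base) auto
    ultimately show ?thesis
      by (intro Lim_in_closed_set[where f = P and F = "finite_subsets_at_top UNIV"])
        (auto intro: always_eventually subsetD[OF closure_subset])
  qed
  then show ?thesis by auto
qed

section \<open>Bessel's inequality, the coefficient map and its inverse\<close>

definition orthonormal :: "('i \<Rightarrow> 'a ell2) \<Rightarrow> bool" where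
  "orthonormal \<phi> \<longleftrightarrow> (\<forall>m m'. cinner (\<phi> m) (\<phi> m') = (if m = m' then 1 else 0))"

lemma orthonormal_basis_orthonormal: "orthonormal_basis \<phi> \<Longrightarrow> orthonormal \<phi>"
  by (simp add: orthonormal_basis_def orthonormal_def)

text \<open>With \<open>p\<close> the projection onto the span of finitely many members, both
  \<open>inner u p\<close> and \<open>inner p p\<close> equal the sum \<open>s\<close>; expanding
  the nonnegative square of \<open>u - p\<close> gives the bound.\<close>

lemma Bessel:
  assumes "orthonormal \<phi>" "finite F"
  shows "(\<Sum>m\<in>F. (cmod (cinner u (\<phi> m)))\<^sup>2) \<le> (norm u)\<^sup>2"
proof -
  define p where "p = (\<Sum>m\<in>F. cinner u (\<phi> m) *\<^sub>C \<phi> m)"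
  define s where "s = (\<Sum>m\<in>F. (cmod (cinner u (\<phi> m)))\<^sup>2)"
  have up: "cinner u p = complex_of_real s"
    unfolding p_def s_def cinner_sum_right cinner_scaleC_right of_real_sum complex_norm_square
    by (simp add: mult.commute)
  have pm: "cinner (\<phi> m) p = cnj (cinner u (\<phi> m))" if "m \<in> F" for m
  proof -
    have "cinner (\<phi> m) p = (\<Sum>m'\<in>F. if m = m' then cnj (cinner u (\<phi> m')) else 0)"
      using assms(1) unfolding p_def orthonormal_def cinner_sum_right cinner_scaleC_right
      by (intro sum.cong) auto
    then show ?thesis using assms(2) that by simp
  qed
  have pp: "cinner p p = complex_of_real s"
    unfolding s_def of_real_sum complex_norm_square
    by (subst (1) p_def) (simp add: cinner_sum_left cinner_scaleC_left pm)
  have "inner u p = s" "inner p p = s" by (simp_all add: inner_ell2_def up pp)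
  moreover have "0 \<le> inner (u - p) (u - p)" by simp
  ultimately show ?thesis
    by (simp add: inner_diff_left inner_diff_right inner_commute power2_norm_eq_inner s_def)
qed

text \<open>\<open>Abs_ell2\<close> is meaningful only on square-summable families. Orthonormality
  provides this through Bessel's inequality, so the map is available before a family is known to be
  complete.\<close>

definition coeffs :: "('i \<Rightarrow> 'a ell2) \<Rightarrow> 'a ell2 \<Rightarrow> 'i ell2" where
  "coeffs \<phi> u = Abs_ell2 (\<lambda>m. cinner u (\<phi> m))"

context
  fixes \<phi> :: "'i \<Rightarrow> 'a ell2"
  assumes on: "orthonormal \<phi>"
begin

lemma coord_coeffs: "coord (coeffs \<phi> u) m = cinner u (\<phi> m)"
  unfolding coeffs_def by (subst coord_Abs_ell2[OF Bessel[OF on]]) auto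

lemma coeffs_add: "coeffs \<phi> (u + v) = coeffs \<phi> u + coeffs \<phi> v"
  by (rule ell2_eqI) (simp add: coord_coeffs plus_ell2.rep_eq cinner_add_left)

lemma coeffs_scaleC: "coeffs \<phi> (c *\<^sub>C u) = c *\<^sub>C coeffs \<phi> u"
  by (rule ell2_eqI) (simp add: coord_coeffs scaleC.rep_eq cinner_scaleC_left)

lemma norm_coeffs_le: "norm (coeffs \<phi> u) \<le> norm u"
  by (rule norm_le_ell2I) (simp_all add: coord_coeffs Bessel on)

lemma bounded_linear_coeffs: "bounded_linear (coeffs \<phi>)"
  by (rule bounded_linear_intro[where K = 1])
    (simp_all add: coeffs_add coeffs_scaleC scaleR_ell2_def norm_coeffs_le)

lemma coeffs_self: "coeffs \<phi> (\<phi> m) = delta m"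
  using on by (intro ell2_eqI) (auto simp: coord_coeffs delta.rep_eq orthonormal_def)

end

text \<open>Polarization recovers the real part of the inner product from norms; replacing
  \<open>u\<close> by \<open>\<i> *\<^sub>C u\<close> turns the imaginary part into a real
  part.\<close>

lemma cinner_isometry:
  assumes add: "\<And>u v. T (u + v) = T u + T v" and scale: "\<And>c u. T (c *\<^sub>C u) = c *\<^sub>C T u"
    and norm: "\<And>u. norm (T u) = norm u"
  shows "cinner (T u) (T v) = cinner u v"
proof -
  have re: "Re (cinner (T u) (T v)) = Re (cinner u v)" for u v
    unfolding inner_ell2_def[symmetric] dot_norm add[symmetric] norm ..
  have "Im (cinner (T u) (T v)) = - Re (cinner (T (\<i> *\<^sub>C u)) (T v))"
    by (simp add: scale cinner_scaleC_left)
  also have "\<dots> = Im (cinner u v)" by (simp add: re cinner_scaleC_left)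
  finally show ?thesis by (simp add: re complex_eq_iff)
qed

lemma eq_on_dense:
  fixes f g :: "'a :: topological_space \<Rightarrow> 'b :: t2_space"
  assumes "continuous_on UNIV f" "continuous_on UNIV g" "closure X = UNIV" "\<And>x. x \<in> X \<Longrightarrow> f x = g x"
  shows "f x = g x"
proof -
  have "closed {x. f x = g x}" using assms(1,2) by (rule closed_Collect_eq)
  then have "closure X \<subseteq> {x. f x = g x}" by (rule closure_minimal[rotated]) (auto intro: assms(4))
  then show ?thesis using assms(3) by auto
qed

text \<open>The inverse of \<open>coeffs \<phi>\<close>, written as the coefficient map of the orthonormal family of images
  of the \<open>delta n\<close>, so that Bessel's inequality supplies the square-summability of the synthesized
  vector and completeness of the space is never needed.\<close>

definition synth :: "('i \<Rightarrow> 'a ell2) \<Rightarrow> 'i ell2 \<Rightarrow> 'a ell2" where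
  "synth \<phi> = coeffs (\<lambda>n. coeffs \<phi> (delta n))"

context
  fixes \<phi> :: "'i \<Rightarrow> 'a ell2"
  assumes basis: "orthonormal_basis \<phi>"
begin

private lemma on: "orthonormal \<phi>"
  using basis by (rule orthonormal_basis_orthonormal)

lemma norm_coeffs: "norm (coeffs \<phi> u) = norm u"
proof (rule eq_on_dense[where X = "ell2.span (range \<phi>)"])
  show "continuous_on UNIV (\<lambda>u. norm (coeffs \<phi> u))"
    by (intro continuous_intros linear_continuous_on bounded_linear_coeffs on)
  show "closure (ell2.span (range \<phi>)) = UNIV" using basis by (simp add: orthonormal_basis_def)
  \<comment> \<open>Preserving the inner product against every \<open>v\<close> is a linear
    condition on \<open>u\<close>, whereas preserving the norm is not; the norm identity on the span
    is then the case \<open>v = u\<close>.\<close>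
  let ?E = "{u. \<forall>v. cinner (coeffs \<phi> u) (coeffs \<phi> v) = cinner u v}"
  have "ell2.subspace ?E"
  proof (rule ell2.subspaceI)
    have "coeffs \<phi> 0 = 0" by (rule linear_simps(3)[OF bounded_linear_coeffs[OF on]])
    then show "0 \<in> ?E" by simp
  qed (auto simp: coeffs_add[OF on] coeffs_scaleC[OF on] cinner_add_left cinner_scaleC_left)
  moreover have "range \<phi> \<subseteq> ?E"
    by (auto simp: coeffs_self[OF on] coord_coeffs[OF on] intro: cinner_commute[symmetric])
  ultimately have sub: "ell2.span (range \<phi>) \<subseteq> ?E" by (rule ell2.span_minimal[rotated])
  fix u assume "u \<in> ell2.span (range \<phi>)"
  with sub have "cinner (coeffs \<phi> u) (coeffs \<phi> u) = cinner u u" by auto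
  then show "norm (coeffs \<phi> u) = norm u" by (simp add: norm_eq_sqrt_inner inner_ell2_def)
qed (intro continuous_intros)

lemma cinner_coeffs: "cinner (coeffs \<phi> u) (coeffs \<phi> v) = cinner u v"
  by (rule cinner_isometry) (simp_all add: coeffs_add coeffs_scaleC norm_coeffs on)

lemma orthonormal_coeffs_delta: "orthonormal (\<lambda>n. coeffs \<phi> (delta n))"
  by (simp add: orthonormal_def cinner_coeffs delta.rep_eq)

lemmas coord_synth_cinner = coord_coeffs[OF orthonormal_coeffs_delta, folded synth_def]
lemmas synth_add = coeffs_add[OF orthonormal_coeffs_delta, folded synth_def]
lemmas synth_scaleC = coeffs_scaleC[OF orthonormal_coeffs_delta, folded synth_def]
lemmas bounded_linear_synth = bounded_linear_coeffs[OF orthonormal_coeffs_delta, folded synth_def]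

lemma coord_synth: "coord (synth \<phi> f) n = (\<Sum>\<^sub>\<infinity>m. coord f m * coord (\<phi> m) n)"
  unfolding coord_synth_cinner by (subst cinner_def) (simp add: coord_coeffs[OF on])

lemma synth_coeffs: "synth \<phi> (coeffs \<phi> u) = u"
  by (rule ell2_eqI) (simp add: coord_synth_cinner cinner_coeffs)

lemma synth_delta: "synth \<phi> (delta m) = \<phi> m"
  using synth_coeffs[of "\<phi> m"] by (simp add: coeffs_self[OF on])

text \<open>This is surjectivity of the coefficient map. Both sides are continuous and linear in
  \<open>f\<close> and agree at each \<open>delta m\<close>, because
  \<open>synth \<phi> (delta m) = \<phi> m\<close>.\<close>

lemma coeffs_synth: "coeffs \<phi> (synth \<phi> f) = f"
proof (rule eq_on_dense[OF _ _ closure_span_delta])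
  show "continuous_on UNIV (\<lambda>f. coeffs \<phi> (synth \<phi> f))"
    by (intro linear_continuous_on bounded_linear_compose[OF bounded_linear_coeffs bounded_linear_synth] on)
  let ?E = "{f. coeffs \<phi> (synth \<phi> f) = f}"
  have "ell2.subspace ?E"
  proof (rule ell2.subspaceI)
    show "0 \<in> ?E"
      by (simp add: linear_simps(3)[OF bounded_linear_synth] linear_simps(3)[OF bounded_linear_coeffs[OF on]])
  qed (auto simp: synth_add synth_scaleC coeffs_add[OF on] coeffs_scaleC[OF on])
  moreover have "range delta \<subseteq> ?E" by (auto simp: synth_delta coeffs_self[OF on])
  ultimately have "ell2.span (range delta) \<subseteq> ?E" by (rule ell2.span_minimal[rotated])
  then show "coeffs \<phi> (synth \<phi> f) = f" if "f \<in> ell2.span (range delta)" for f using that by auto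
qed (intro continuous_intros)

lemma norm_synth: "norm (synth \<phi> f) = norm f"
  using norm_coeffs[of "synth \<phi> f"] by (simp add: coeffs_synth)

text \<open>Parseval's identity for the unit vector \<open>delta n\<close>, whose coefficients are
  the conjugates of the values at \<open>n\<close> of the basis vectors.\<close>

lemma has_sum_basis_coord: "((\<lambda>m. (cmod (coord (\<phi> m) n))\<^sup>2) has_sum 1) UNIV"
proof -
  have "norm (delta n) = 1" by (simp add: norm_eq_sqrt_inner inner_ell2_def delta.rep_eq)
  then show ?thesis
    using has_sum_norm_ell2[of "coeffs \<phi> (delta n)"] by (simp add: norm_coeffs coord_coeffs[OF on])
qed

end

section \<open>The propagator of an operator with an eigenbasis\<close>

lift_definition phase :: "('i \<Rightarrow> real) \<Rightarrow> real \<Rightarrow> 'i ell2 \<Rightarrow> 'i ell2"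
  is "\<lambda>l t f m. cis (- (l m * t)) * f m"
  by (simp add: norm_mult)

lemma norm_phase: "norm (phase l t f) = norm f"
  by (simp add: norm_ell2_sq phase.rep_eq norm_mult flip: power2_eq_iff_nonneg[of "norm _"])

lemma phase_add: "phase l t (f + g) = phase l t f + phase l t g"
  by transfer (simp add: algebra_simps)

lemma phase_scaleC: "phase l t (c *\<^sub>C f) = c *\<^sub>C phase l t f"
  by transfer (simp add: algebra_simps)

lemma phase_phase: "phase l s (phase l t f) = phase l (s + t) f"
  by transfer (simp add: cis_mult algebra_simps fun_eq_iff flip: mult.assoc)

lemma phase_0: "phase l 0 f = f"
  by transfer simp

lemma continuous_on_phase: "continuous_on UNIV (\<lambda>t. phase l t f)"
proof -
  have "((\<lambda>t. phase l t f - phase l s f) \<longlongrightarrow> 0) (at s)" for s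
  proof (rule dominated_convergence_ell2)
    fix m
    have "((\<lambda>t. coord (phase l t f - phase l s f) m) \<longlongrightarrow> cis (- (l m * s)) * coord f m - cis (- (l m * s)) * coord f m) (at s)"
      unfolding minus_ell2.rep_eq phase.rep_eq cis_conv_exp by (intro tendsto_intros)
    then show "((\<lambda>t. coord (phase l t f - phase l s f) m) \<longlongrightarrow> 0) (at s)" by simp
    fix t
    have "cmod (coord (phase l t f - phase l s f) m) \<le> cmod (coord f m) + cmod (coord f m)"
      unfolding minus_ell2.rep_eq phase.rep_eq
      by (rule order_trans[OF norm_triangle_ineq4]) (simp add: norm_mult)
    also have "\<dots> = cmod (coord (2 *\<^sub>C f) m)" by (simp add: scaleC.rep_eq norm_mult)
    finally show "cmod (coord (phase l t f - phase l s f) m) \<le> cmod (coord (2 *\<^sub>C f) m)" .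
  qed
  then show ?thesis by (simp add: continuous_on_def LIM_zero_iff)
qed

text \<open>A chord of the unit circle is no longer than its arc. This bounds the difference
  quotients of a phase by the modulus of its eigenvalue, uniformly in time.\<close>

lemma cmod_cis_minus_1_le: "cmod (cis x - 1) \<le> \<bar>x\<bar>"
  using dist_exp_i_1[of x] abs_sin_le_one abs_sin_x_le_abs_x[of "x / 2"]
  by (simp add: cis_conv_exp mult.commute)

text \<open>Rephrases differentiability as convergence to zero of one vector, the shape needed for
  dominated convergence.\<close>

lemma has_vector_derivative_at_iff_quotient:
  "(f has_vector_derivative D) (at x) \<longleftrightarrow>
     ((\<lambda>h. (1 / h) *\<^sub>R (f (x + h) - f x) - D) \<longlongrightarrow> 0) (at 0)"
proof -
  have "norm (f (x + h) - f x - h *\<^sub>R D) / norm h = norm ((1 / h) *\<^sub>R (f (x + h) - f x) - D)"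
    if "h \<noteq> 0" for h
  proof -
    have "(1 / h) *\<^sub>R (f (x + h) - f x) - D = (1 / h) *\<^sub>R (f (x + h) - f x - h *\<^sub>R D)"
      using that by (simp add: scaleR_diff_right)
    then show ?thesis by simp
  qed
  then have "((\<lambda>h. norm (f (x + h) - f x - h *\<^sub>R D) / norm h) \<longlongrightarrow> 0) (at 0) \<longleftrightarrow>
      ((\<lambda>h. norm ((1 / h) *\<^sub>R (f (x + h) - f x) - D)) \<longlongrightarrow> 0) (at 0)"
    by (intro Lim_cong_within) auto
  then show ?thesis
    by (simp add: has_vector_derivative_def has_derivative_at bounded_linear_scaleR_left tendsto_norm_zero_iff)
qed

text \<open>The generator is the maximal multiplication operator: that the multiplied family is the
  coordinate family of a vector \<open>g\<close> is exactly the domain condition. One direction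
  differentiates each coordinate; the other uses dominated convergence with majorant
  \<open>2 *\<^sub>C g\<close>.\<close>

lemma phase_has_vector_derivative_iff:
  "((\<lambda>t. phase l t f) has_vector_derivative (- \<i>) *\<^sub>C g) (at 0) \<longleftrightarrow>
     (\<forall>m. coord g m = complex_of_real (l m) * coord f m)"
  (is "?L \<longleftrightarrow> ?R")
proof
  have der: "((\<lambda>t. cis (- (l m * t)) * coord f m) has_vector_derivative
               - \<i> * (complex_of_real (l m) * coord f m)) (at 0)" for m
  proof -
    have "((\<lambda>t. exp (- (\<i> * complex_of_real (l m)) * t) * coord f m) has_field_derivative
             - \<i> * (complex_of_real (l m) * coord f m)) (at (complex_of_real 0))"
      by (auto intro!: derivative_eq_intros)
    from has_vector_derivative_real_field[OF this]
    show ?thesis by (simp add: cis_conv_exp mult_ac)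
  qed
  {
    assume ?L
    show ?R
    proof
      fix m
      have "((\<lambda>t. coord (phase l t f) m) has_vector_derivative coord ((- \<i>) *\<^sub>C g) m) (at 0)"
        by (rule bounded_linear.has_vector_derivative[OF bounded_linear_coord \<open>?L\<close>])
      from vector_derivative_unique_at[OF this[unfolded phase.rep_eq] der]
      show "coord g m = complex_of_real (l m) * coord f m" by (simp add: scaleC.rep_eq del: ell2.scale_minus_left)
    qed
  }
  assume R: ?R
  define Q where "Q t = (1 / t) *\<^sub>R (phase l t f - f) - (- \<i>) *\<^sub>C g" for t
  have "(Q \<longlongrightarrow> 0) (at 0)"
  proof (rule dominated_convergence_ell2)
    fix m
    show "((\<lambda>t. coord (Q t) m) \<longlongrightarrow> 0) (at 0)"
      using der[of m, unfolded has_vector_derivative_at_iff_quotient] R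
      unfolding Q_def minus_ell2.rep_eq coord_scaleR phase.rep_eq scaleC.rep_eq scaleR_conv_of_real
      by simp
    fix t
    have "cmod (coord (Q t) m) \<le> cmod (coord g m) + cmod (coord g m)"
    proof -
      \<comment> \<open>The bound must also hold at \<open>t = 0\<close>, where the quotient is 0 by
        the convention for division by zero.\<close>
      have "cmod (cis (- (l m * t)) - 1) / \<bar>t\<bar> \<le> \<bar>l m\<bar>"
        using cmod_cis_minus_1_le[of "- (l m * t)"] by (cases "t = 0") (auto simp: divide_simps abs_mult)
      then have "cmod (cis (- (l m * t)) - 1) / \<bar>t\<bar> * cmod (coord f m) \<le> \<bar>l m\<bar> * cmod (coord f m)"
        by (rule mult_right_mono) simp
      also have "cmod (cis (- (l m * t)) - 1) / \<bar>t\<bar> * cmod (coord f m)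
          = cmod (complex_of_real (1 / t) * (cis (- (l m * t)) * coord f m - coord f m))"
        by (simp add: norm_mult norm_divide left_diff_distrib flip: norm_mult)
      finally have "cmod (complex_of_real (1 / t) * (cis (- (l m * t)) * coord f m - coord f m)) \<le> cmod (coord g m)"
        using R by (simp add: norm_mult)
      then show ?thesis
        unfolding Q_def minus_ell2.rep_eq coord_scaleR phase.rep_eq scaleC.rep_eq
        by (intro order_trans[OF norm_triangle_ineq4] add_mono) (simp_all add: norm_mult)
    qed
    also have "\<dots> = cmod (coord (2 *\<^sub>C g) m)" by (simp add: scaleC.rep_eq norm_mult)
    finally show "cmod (coord (Q t) m) \<le> cmod (coord (2 *\<^sub>C g) m)" .
  qed
  then show ?L
    by (simp add: has_vector_derivative_at_iff_quotient Q_def[abs_def] phase_0 del: ell2.scale_minus_left)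
qed

section \<open>Unitary groups, self-adjointness and the propagator\<close>

definition diagonal_group :: "('i \<Rightarrow> 'a ell2) \<Rightarrow> ('i \<Rightarrow> real) \<Rightarrow> real \<Rightarrow> 'a ell2 \<Rightarrow> 'a ell2" where
  "diagonal_group \<phi> l t u = synth \<phi> (phase l t (coeffs \<phi> u))"

lemma unitary_group_linear:
  assumes "unitary_group U"
  shows "U t (u + v) = U t u + U t v" "U t (c *\<^sub>C u) = c *\<^sub>C U t u"
  using assms by (auto simp: unitary_group_def unitary_def linear_operator_def)

lemma unitary_group_bounded_linear:
  assumes "unitary_group U"
  shows "bounded_linear (U t)"
proof (rule bounded_linear_intro[where K = 1])
  have "cinner (U t u) (U t u) = cinner u u" for u
    using assms by (auto simp: unitary_group_def unitary_def)
  then show "norm (U t u) \<le> norm u * 1" for u by (simp add: norm_eq_sqrt_inner inner_ell2_def)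
qed (simp_all add: unitary_group_linear[OF assms] scaleR_ell2_def)

text \<open>The group law carries the derivative from 0 to every time \<open>s\<close>, which yields
  a linear differential equation for each coordinate. The integrating factor
  \<open>cis (l * t)\<close> makes the coordinate constant.\<close>

lemma unitary_group_eigenvector:
  assumes U: "unitary_group U"
    and der: "((\<lambda>t. U t u) has_vector_derivative (- \<i>) *\<^sub>C (complex_of_real l *\<^sub>C u)) (at 0)"
  shows "U t u = cis (- (l * t)) *\<^sub>C u"
proof (rule ell2_eqI)
  fix x
  have semi: "U (s + h) u = U s (U h u)" for s h
    using U by (simp add: unitary_group_def)
  have "((\<lambda>t. U t u) has_vector_derivative (- (\<i> * complex_of_real l)) *\<^sub>C U s u) (at s)" for s
  proof -
    have "((\<lambda>h. U s (U h u)) has_vector_derivative U s ((- \<i>) *\<^sub>C (complex_of_real l *\<^sub>C u))) (at (s - s))"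
      using bounded_linear.has_vector_derivative[OF unitary_group_bounded_linear[OF U] der] by simp
    moreover have "((\<lambda>t. t - s) has_real_derivative 1) (at s)"
      by (auto intro!: derivative_eq_intros)
    ultimately have "((\<lambda>h. U s (U h u)) \<circ> (\<lambda>t. t - s) has_vector_derivative
        1 *\<^sub>R U s ((- \<i>) *\<^sub>C (complex_of_real l *\<^sub>C u))) (at s)"
      by (intro vector_diff_chain_at) (simp_all add: has_real_derivative_iff_has_vector_derivative)
    then show ?thesis by (simp add: o_def unitary_group_linear[OF U] del: ell2.scale_minus_left flip: semi)
  qed
  from bounded_linear.has_vector_derivative[OF bounded_linear_coord this]
  have coord_der: "((\<lambda>t. coord (U t u) x) has_vector_derivative
      - (\<i> * complex_of_real l) * coord (U s u) x) (at s)" for s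
    by (simp add: scaleC.rep_eq del: ell2.scale_minus_left)
  have cis_der: "((\<lambda>t. cis (l * t)) has_vector_derivative \<i> * complex_of_real l * cis (l * s)) (at s)" for s
  proof -
    have "((\<lambda>t. exp (\<i> * complex_of_real l * t)) has_field_derivative
             \<i> * complex_of_real l * exp (\<i> * complex_of_real l * complex_of_real s)) (at (complex_of_real s))"
      by (auto intro!: derivative_eq_intros)
    from has_vector_derivative_real_field[OF this]
    show ?thesis by (simp add: cis_conv_exp mult_ac)
  qed
  have "((\<lambda>t. cis (l * t) * coord (U t u) x) has_vector_derivative 0) (at s)" for s
    using has_vector_derivative_mult[OF cis_der coord_der, of s] by (simp add: algebra_simps)
  then obtain c where "\<And>t. cis (l * t) * coord (U t u) x = c"
    by (auto intro: has_vector_derivative_zero_constant[of UNIV "\<lambda>t. cis (l * t) * coord (U t u) x"])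
  then have "cis (l * t) * coord (U t u) x = cis (l * 0) * coord (U 0 u) x" by metis
  then have "cis (- (l * t)) * (cis (l * t) * coord (U t u) x) = cis (- (l * t)) * coord u x"
    using U by (simp add: unitary_group_def)
  then show "coord (U t u) x = coord (cis (- (l * t)) *\<^sub>C u) x"
    by (simp add: scaleC.rep_eq cis_mult flip: mult.assoc)
qed

context
  fixes \<phi> :: "'i \<Rightarrow> 'a ell2"
  assumes basis: "orthonormal_basis \<phi>"
begin

private lemma ortho: "orthonormal \<phi>"
  using basis by (rule orthonormal_basis_orthonormal)

lemma unitary_group_diagonal: "unitary_group (diagonal_group \<phi> l)"
proof -
  have add: "diagonal_group \<phi> l t (u + v) = diagonal_group \<phi> l t u + diagonal_group \<phi> l t v"
    and scale: "diagonal_group \<phi> l t (c *\<^sub>C u) = c *\<^sub>C diagonal_group \<phi> l t u" for t u v c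
    by (simp_all add: diagonal_group_def coeffs_add coeffs_scaleC ortho phase_add phase_scaleC
        synth_add synth_scaleC basis)
  have comp: "diagonal_group \<phi> l s (diagonal_group \<phi> l t u) = diagonal_group \<phi> l (s + t) u" for s t u
    by (simp add: diagonal_group_def coeffs_synth basis phase_phase)
  have zero: "diagonal_group \<phi> l 0 u = u" for u
    by (simp add: diagonal_group_def phase_0 synth_coeffs basis)
  have "unitary (diagonal_group \<phi> l t)" for t
    unfolding unitary_def linear_operator_def
  proof (intro conjI allI ballI)
    show "surj (diagonal_group \<phi> l t)"
      by (rule surjI[of _ "diagonal_group \<phi> l (- t)"]) (simp add: comp zero)
    show "cinner (diagonal_group \<phi> l t u) (diagonal_group \<phi> l t v) = cinner u v" for u v
      by (rule cinner_isometry) (simp_all add: add scale, simp add: diagonal_group_def norm_synth norm_phase norm_coeffs basis)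
  qed (simp_all add: add scale ell2.subspace_UNIV)
  moreover have "continuous_on UNIV (\<lambda>t. diagonal_group \<phi> l t u)" for u
    unfolding diagonal_group_def
    by (rule bounded_linear.continuous_on[OF bounded_linear_synth[OF basis] continuous_on_phase])
  ultimately show ?thesis
    by (auto simp: unitary_group_def comp zero fun_eq_iff)
qed

lemma diagonal_group_has_vector_derivative_iff:
  "((\<lambda>t. diagonal_group \<phi> l t u) has_vector_derivative (- \<i>) *\<^sub>C v) (at 0) \<longleftrightarrow>
     (\<forall>m. cinner v (\<phi> m) = complex_of_real (l m) * cinner u (\<phi> m))"
proof -
  have "((\<lambda>t. diagonal_group \<phi> l t u) has_vector_derivative (- \<i>) *\<^sub>C v) (at 0) \<longleftrightarrow>
      ((\<lambda>t. phase l t (coeffs \<phi> u)) has_vector_derivative (- \<i>) *\<^sub>C coeffs \<phi> v) (at 0)"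
    using bounded_linear.has_vector_derivative[OF bounded_linear_coeffs[OF ortho],
        of "\<lambda>t. diagonal_group \<phi> l t u" "(- \<i>) *\<^sub>C v" "at 0"]
      bounded_linear.has_vector_derivative[OF bounded_linear_synth[OF basis],
        of "\<lambda>t. phase l t (coeffs \<phi> u)" "(- \<i>) *\<^sub>C coeffs \<phi> v" "at 0"]
    by (auto simp: diagonal_group_def coeffs_synth synth_coeffs synth_scaleC coeffs_scaleC ortho basis
        simp del: ell2.scale_minus_left)
  then show ?thesis by (simp add: phase_has_vector_derivative_iff coord_coeffs ortho del: ell2.scale_minus_left)
qed

text \<open>Symmetry puts the graph of \<open>H\<close> inside that of the maximal multiplication
  operator. Conversely, for a pair \<open>(u, v)\<close> in the latter, Parseval's identity and the
  reality of \<open>l\<close> give \<open>cinner (H w) u = cinner w v\<close> on \<open>D\<close>,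
  so the pair lies in the adjoint graph, which is the graph of \<open>H\<close>.\<close>

lemma self_adjoint_graph_eigenbasis:
  assumes sa: "self_adjoint D H" and eigen: "\<And>m. \<phi> m \<in> D" "\<And>m. H (\<phi> m) = complex_of_real (l m) *\<^sub>C \<phi> m"
  shows "operator_graph D H =
    {(u, v). \<forall>m. cinner v (\<phi> m) = complex_of_real (l m) * cinner u (\<phi> m)}"
proof -
  have adj: "adjoint_graph D H = operator_graph D H" using sa by (simp add: self_adjoint_def)
  have symm: "cinner (H u) v = cinner u (H v)" if "u \<in> D" "v \<in> D" for u v
  proof -
    have "(v, H v) \<in> adjoint_graph D H" using that by (auto simp: adj operator_graph_def)
    with that show ?thesis by (auto simp: adjoint_graph_def)
  qed
  have coeff: "cinner (H u) (\<phi> m) = complex_of_real (l m) * cinner u (\<phi> m)" if "u \<in> D" for u m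
    using that by (simp add: symm eigen cinner_scaleC_right)
  have "(u, v) \<in> adjoint_graph D H"
    if uv: "\<forall>m. cinner v (\<phi> m) = complex_of_real (l m) * cinner u (\<phi> m)" for u v
    unfolding adjoint_graph_def
  proof clarify
    fix w assume w: "w \<in> D"
    have "cinner (coeffs \<phi> (H w)) (coeffs \<phi> u) = cinner (coeffs \<phi> w) (coeffs \<phi> v)"
      by (simp add: cinner_def[of "coeffs _ _"] coord_coeffs ortho coeff[OF w] uv mult_ac)
    then show "cinner (H w) u = cinner w v" by (simp add: cinner_coeffs basis)
  qed
  then show ?thesis by (auto simp: adj operator_graph_def coeff)
qed

text \<open>The definite description asks for existence and uniqueness. The diagonal group has the
  right generator by the graph identity. Any competitor multiplies each \<open>\<phi> m\<close> by
  the same phase, hence agrees on the dense span and, being bounded, everywhere.\<close>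

lemma propagator_eq_diagonal_group:
  assumes sa: "self_adjoint D H" and eigen: "\<And>m. \<phi> m \<in> D" "\<And>m. H (\<phi> m) = complex_of_real (l m) *\<^sub>C \<phi> m"
  shows "propagator D H = diagonal_group \<phi> l"
  unfolding propagator_def
proof (rule the_equality)
  show "unitary_group (diagonal_group \<phi> l) \<and>
      {(u, v). ((\<lambda>t. diagonal_group \<phi> l t u) has_vector_derivative (- \<i>) *\<^sub>C v) (at 0)} = operator_graph D H"
    by (simp add: unitary_group_diagonal diagonal_group_has_vector_derivative_iff
        self_adjoint_graph_eigenbasis[OF assms] del: ell2.scale_minus_left)
  fix V
  assume V: "unitary_group V \<and>
      {(u, v). ((\<lambda>t. V t u) has_vector_derivative (- \<i>) *\<^sub>C v) (at 0)} = operator_graph D H"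
  show "V = diagonal_group \<phi> l"
  proof (intro ext)
    fix t u
    show "V t u = diagonal_group \<phi> l t u"
    proof (rule eq_on_dense[where X = "ell2.span (range \<phi>)" and f = "V t" and g = "diagonal_group \<phi> l t"])
      show "continuous_on UNIV (V t)" "continuous_on UNIV (diagonal_group \<phi> l t)"
        using V by (auto intro!: linear_continuous_on unitary_group_bounded_linear unitary_group_diagonal)
      show "closure (ell2.span (range \<phi>)) = UNIV" using basis by (simp add: orthonormal_basis_def)
      let ?E = "{u. V t u = diagonal_group \<phi> l t u}"
      have "ell2.subspace ?E"
      proof (rule ell2.subspaceI)
        show "0 \<in> ?E"
          using V by (simp add: linear_simps(3)[OF unitary_group_bounded_linear] unitary_group_diagonal)
      qed (use V in \<open>auto simp: unitary_group_linear unitary_group_diagonal\<close>)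
      moreover have "\<phi> m \<in> ?E" for m
      proof -
        have "(\<phi> m, complex_of_real (l m) *\<^sub>C \<phi> m) \<in> operator_graph D H"
          using eigen by (auto simp: operator_graph_def)
        then have "((\<lambda>t. V t (\<phi> m)) has_vector_derivative (- \<i>) *\<^sub>C (complex_of_real (l m) *\<^sub>C \<phi> m)) (at 0)"
          using V by blast
        then have "V t (\<phi> m) = cis (- (l m * t)) *\<^sub>C \<phi> m"
          using V by (intro unitary_group_eigenvector) auto
        moreover have "phase l t (delta m) = cis (- (l m * t)) *\<^sub>C delta m"
          by (rule ell2_eqI) (simp add: phase.rep_eq scaleC.rep_eq delta.rep_eq)
        then have "diagonal_group \<phi> l t (\<phi> m) = cis (- (l m * t)) *\<^sub>C \<phi> m"
          by (simp add: diagonal_group_def coeffs_self ortho synth_scaleC synth_delta basis)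
        ultimately show ?thesis by simp
      qed
      ultimately have "ell2.span (range \<phi>) \<subseteq> ?E" by (intro ell2.span_minimal) auto
      then show "V t u = diagonal_group \<phi> l t u" if "u \<in> ell2.span (range \<phi>)" for u using that by auto
    qed
  qed
qed

lemma self_adjoint_eigenvalues_real:
  assumes sa: "self_adjoint D H" and eigen: "\<And>m. eigenfunction D H (\<phi> m)"
  obtains l where "\<And>m. \<phi> m \<in> D" "\<And>m. H (\<phi> m) = complex_of_real (l m) *\<^sub>C \<phi> m"
proof -
  have D: "\<phi> m \<in> D" for m using eigen by (simp add: eigenfunction_def)
  have "\<exists>l. H (\<phi> m) = complex_of_real l *\<^sub>C \<phi> m" for m
  proof -
    obtain z where z: "H (\<phi> m) = z *\<^sub>C \<phi> m" using eigen by (auto simp: eigenfunction_def)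
    have "(\<phi> m, H (\<phi> m)) \<in> adjoint_graph D H"
      using sa D by (auto simp: self_adjoint_def operator_graph_def)
    then have "cinner (H (\<phi> m)) (\<phi> m) = cinner (\<phi> m) (H (\<phi> m))"
      using D by (auto simp: adjoint_graph_def)
    then have "z = cnj z"
      using ortho by (simp add: z cinner_scaleC_left cinner_scaleC_right orthonormal_def)
    then have "z = complex_of_real (Re z)" by (simp add: complex_eq_iff)
    with z show ?thesis by metis
  qed
  then show ?thesis using D that by metis
qed

text \<open>Expanded in the eigenbasis, the matrix element is a sum of products of basis values with
  unimodular phases. The triangle inequality removes the phases, so the bound is uniform in
  \<open>t\<close> and in the eigenvalues.\<close>

lemma cmod_diagonal_group_le:
  assumes "(\<lambda>m. cmod (coord (\<phi> m) k) * cmod (coord (\<phi> m) n)) summable_on UNIV"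
  shows "cmod (cinner (diagonal_group \<phi> l t (delta k)) (delta n))
    \<le> (\<Sum>\<^sub>\<infinity>m. cmod (coord (\<phi> m) k) * cmod (coord (\<phi> m) n))"
  unfolding cinner_delta_right diagonal_group_def coord_synth[OF basis] phase.rep_eq
    coord_coeffs[OF ortho] cinner_delta_left
  by (rule order_trans[OF norm_infsum_bound]) (use assms in \<open>simp_all add: norm_mult\<close>)

end

section \<open>Counting localization centers\<close>

lemma supnorm_le_iff: "supnorm n \<le> k \<longleftrightarrow> (\<forall>i. \<bar>n $ i\<bar> \<le> k)"
  by (simp add: supnorm_def)

lemma supnorm_nonneg: "0 \<le> supnorm n"
proof -
  have "\<bar>n $ i\<bar> \<le> supnorm n" for i using supnorm_le_iff[of n "supnorm n"] by simp
  then show ?thesis using abs_ge_zero order_trans by blast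
qed

lemma supnorm_add_le: "supnorm (a + b) \<le> supnorm a + supnorm b"
proof -
  have "\<bar>a $ i\<bar> \<le> supnorm a" "\<bar>b $ i\<bar> \<le> supnorm b" for i
    using supnorm_le_iff[of a "supnorm a"] supnorm_le_iff[of b "supnorm b"] by simp_all
  then show ?thesis
    unfolding supnorm_le_iff vector_add_component by (meson abs_triangle_ineq add_mono order_trans)
qed

lemma bracket_ge_1: "1 \<le> bracket n"
  using supnorm_nonneg[of n] by (simp add: bracket_def)

lemma bracket_pos: "0 < bracket n"
  using bracket_ge_1[of n] by linarith

lemma bracket_minus_commute: "bracket (a - b) = bracket (b - a)"
  by (simp add: bracket_def supnorm_def abs_minus_commute)

lemma bracket_le_add: "bracket a \<le> bracket (a - b) + bracket b"
  using supnorm_add_le[of "a - b" b] by (simp add: bracket_def)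

text \<open>For \<open>x\<close> and \<open>y\<close> at least 1,
  \<open>(x - 1) * (y - 1) \<ge> 0\<close> turns the triangle inequality for the shifted norm into
  submultiplicativity.\<close>

lemma bracket_le_mult: "bracket a \<le> bracket b * bracket (a - b)"
proof -
  have "bracket a \<le> bracket b + bracket (a - b) - 1"
    using supnorm_add_le[of "a - b" b] by (simp add: bracket_def)
  moreover have "0 \<le> (bracket b - 1) * (bracket (a - b) - 1)"
    using bracket_ge_1 by (intro mult_nonneg_nonneg) auto
  ultimately show ?thesis by (simp add: algebra_simps)
qed

lemma card_cube:
  assumes "finite A"
  shows "finite {n :: 'a ^ 'd. \<forall>i. n $ i \<in> A}" "card {n :: 'a ^ 'd. \<forall>i. n $ i \<in> A} = card A ^ CARD('d)"
proof -
  have bij: "bij_betw vec_nth {n :: 'a ^ 'd. \<forall>i. n $ i \<in> A} (PiE UNIV (\<lambda>_. A))"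
    by (rule bij_betw_byWitness[where f' = vec_lambda]) auto
  show "finite {n :: 'a ^ 'd. \<forall>i. n $ i \<in> A}"
    using bij_betw_finite[OF bij] assms by (simp add: finite_PiE)
  show "card {n :: 'a ^ 'd. \<forall>i. n $ i \<in> A} = card A ^ CARD('d)"
    using bij_betw_same_card[OF bij] by (simp add: card_PiE)
qed

text \<open>Since the bracket is the norm plus 1, the coordinates range up to \<lfloor>R\<rfloor> -
  1 in modulus, so a side has 2 \<lfloor>R\<rfloor> - 1 points when R \<ge> 1.\<close>

lemma bracket_ball_eq_cube:
  "{n :: int ^ 'd. bracket n \<le> R} = {n. \<forall>i. n $ i \<in> {1 - \<lfloor>R\<rfloor>..\<lfloor>R\<rfloor> - 1}}"
proof -
  have "bracket n \<le> R \<longleftrightarrow> supnorm n \<le> \<lfloor>R\<rfloor> - 1" for n :: "int ^ 'd"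
    unfolding bracket_def by linarith
  moreover have "\<bar>x\<bar> \<le> \<lfloor>R\<rfloor> - 1 \<longleftrightarrow> x \<in> {1 - \<lfloor>R\<rfloor>..\<lfloor>R\<rfloor> - 1}" for x by auto
  ultimately show ?thesis unfolding supnorm_le_iff by simp
qed

lemma finite_bracket_ball: "finite {n :: int ^ 'd. bracket n \<le> R}"
  unfolding bracket_ball_eq_cube by (rule card_cube) simp

lemma card_bracket_ball:
  "card {n :: int ^ 'd. bracket n \<le> R} = nat (2 * \<lfloor>R\<rfloor> - 1) ^ CARD('d)"
  unfolding bracket_ball_eq_cube card_cube(2)[OF finite_atLeastAtMost_int] by (simp add: algebra_simps)

lemma card_bracket_ball_le:
  assumes "R \<ge> 0" shows "real (card {n :: int ^ 'd. bracket n \<le> R}) \<le> (2 * R) ^ CARD('d)"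
  unfolding card_bracket_ball of_nat_power using assms by (intro power_mono) linarith+

text \<open>The constant 3 is the 1 in the side length 2 \<lfloor>R\<rfloor> - 1 plus the 2 lost
  through \<lfloor>R\<rfloor> > R - 1. The hypothesis keeps the base nonnegative.\<close>

lemma card_bracket_ball_ge:
  assumes "2 * R \<ge> 3" shows "(2 * R - 3) ^ CARD('d) \<le> real (card {n :: int ^ 'd. bracket n \<le> R})"
  unfolding card_bracket_ball of_nat_power using assms by (intro power_mono) linarith+

lemma powr_square: "(x powr a)\<^sup>2 = x powr (2 * a)" for x :: real
  by (simp add: power2_eq_square flip: powr_add)

text \<open>Dyadic decomposition: the shell with index \<open>i\<close> has at most
  \<open>K * 2 powr ((i + 1) * d)\<close> members, each contributing at most
  \<open>2 powr - (i * s)\<close>, which leaves a geometric series of ratio \<open>q\<close>. The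
  weight is abstract so that it can be the bracket of a site or of a localization center.\<close>

lemma sum_powr_bounded_of_card_le:
  fixes w :: "'m \<Rightarrow> real"
  assumes w: "\<And>m. 1 \<le> w m"
    and fin: "\<And>L. L \<ge> 1 \<Longrightarrow> finite {m. w m \<le> L}"
    and card: "\<And>L. L \<ge> 1 \<Longrightarrow> real (card {m. w m \<le> L}) \<le> K * L powr d"
    and s: "d < s" and "0 \<le> s"
  obtains S where "0 \<le> S" "\<And>F. finite F \<Longrightarrow> (\<Sum>m\<in>F. w m powr - s) \<le> S"
proof -
  define q where "q = 2 powr (d - s)"
  have q: "0 < q" "q < 1" using powr_less_mono[of "d - s" 0 2] s by (simp_all add: q_def)
  have K: "0 \<le> K" using card[of 1] by (simp add: order_trans[OF of_nat_0_le_iff])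
  define g where "g m = nat \<lfloor>log 2 (w m)\<rfloor>" for m
  have g: "2 powr real (g m) \<le> w m" "w m \<le> 2 powr (real (g m) + 1)" for m
  proof -
    have "0 \<le> log 2 (w m)" using w[of m] by simp
    then have "real (g m) \<le> log 2 (w m)" "log 2 (w m) \<le> real (g m) + 1"
      unfolding g_def by linarith+
    then show "2 powr real (g m) \<le> w m" "w m \<le> 2 powr (real (g m) + 1)"
      using w[of m] by (simp_all add: le_log_iff log_le_iff)
  qed
  show ?thesis
  proof
    show "0 \<le> K * 2 powr d * (1 / (1 - q))" using K q by simp
    fix F :: "'m set" assume F: "finite F"
    have "(\<Sum>m\<in>F. w m powr - s) = (\<Sum>i\<in>g ` F. \<Sum>m\<in>{m \<in> F. g m = i}. w m powr - s)"
      using F by (intro sum.group[symmetric]) auto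
    also have "\<dots> \<le> (\<Sum>i\<in>g ` F. K * 2 powr d * q ^ i)"
    proof (rule sum_mono)
      fix i
      have "(\<Sum>m\<in>{m \<in> F. g m = i}. w m powr - s) \<le> (\<Sum>m\<in>{m \<in> F. g m = i}. (2 powr real i) powr - s)"
        using g(1) \<open>0 \<le> s\<close> by (intro sum_mono powr_mono2') auto
      also have "\<dots> = real (card {m \<in> F. g m = i}) * 2 powr - (real i * s)"
        by (simp add: powr_powr)
      also have "real (card {m \<in> F. g m = i}) \<le> real (card {m. w m \<le> 2 powr (real i + 1)})"
        using g(2) by (intro of_nat_mono card_mono fin) (auto simp: ge_one_powr_ge_zero)
      also have "\<dots> \<le> K * (2 powr (real i + 1)) powr d"
        by (intro card) (simp add: ge_one_powr_ge_zero)
      finally show "(\<Sum>m\<in>{m \<in> F. g m = i}. w m powr - s) \<le> K * 2 powr d * q ^ i"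
        by (simp add: mult_right_mono powr_powr q_def algebra_simps flip: powr_realpow powr_add)
    qed
    also have "\<dots> = K * 2 powr d * (\<Sum>i\<in>g ` F. q ^ i)" by (simp add: sum_distrib_left)
    also have "(\<Sum>i\<in>g ` F. q ^ i) \<le> (\<Sum>i. q ^ i)"
      using F q by (intro sum_le_suminf summable_geometric) auto
    also have "(\<Sum>i. q ^ i) = 1 / (1 - q)" using q by (intro suminf_geometric) auto
    finally show "(\<Sum>m\<in>F. w m powr - s) \<le> K * 2 powr d * (1 / (1 - q))"
      using K by (simp add: mult_left_mono)
  qed
qed

lemma sum_bracket_powr_bounded:
  assumes "real CARD('d) < s"
  obtains Z where "0 \<le> Z" "\<And>F (a :: int ^ 'd). finite F \<Longrightarrow> (\<Sum>n\<in>F. bracket (n - a) powr - s) \<le> Z"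
proof -
  obtain Z where Z: "0 \<le> Z" "\<And>F. finite F \<Longrightarrow> (\<Sum>n\<in>F. bracket (n :: int ^ 'd) powr - s) \<le> Z"
  proof (rule sum_powr_bounded_of_card_le[of bracket "2 ^ CARD('d)" "real CARD('d)" s])
    show "real (card {n :: int ^ 'd. bracket n \<le> L}) \<le> 2 ^ CARD('d) * L powr real CARD('d)" if "L \<ge> 1" for L
      using card_bracket_ball_le[of L] that by (simp add: powr_realpow power_mult_distrib)
  qed (use assms in \<open>auto simp: bracket_ge_1 finite_bracket_ball\<close>)
  show ?thesis
  proof
    fix F :: "(int ^ 'd) set" and a assume "finite F"
    then show "(\<Sum>n\<in>F. bracket (n - a) powr - s) \<le> Z"
      using Z(2)[of "(\<lambda>n. n - a) ` F"] by (simp add: sum.reindex o_def inj_on_def)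
  qed (rule Z(1))
qed

text \<open>Turns a tail estimate into a lower bound for the mass inside a finite set. It is applied
  both to the sum over sites and to the sum over eigenfunctions.\<close>

lemma has_sum_diff_le_finite_sum:
  fixes f :: "'a \<Rightarrow> real"
  assumes "(f has_sum S) UNIV" "\<And>x. 0 \<le> f x" "finite A"
    and outside: "\<And>F. finite F \<Longrightarrow> F \<inter> A = {} \<Longrightarrow> sum f F \<le> t"
  shows "S - t \<le> sum f A"
proof -
  have "S \<le> sum f A + t"
  proof (rule has_sum_le_finite_sums[OF assms(1)])
    fix F :: "'a set" assume "finite F"
    then have "sum f F \<le> sum f (A \<union> (F - A))" using assms by (intro sum_mono2) auto
    also have "\<dots> = sum f A + sum f (F - A)" using \<open>finite F\<close> \<open>finite A\<close> by (intro sum.union_disjoint) auto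
    also have "\<dots> \<le> sum f A + t" using \<open>finite F\<close> by (intro add_left_mono outside) auto
    finally show "sum f F \<le> sum f A + t" .
  qed
  then show ?thesis by simp
qed

section \<open>Density of the localization centers\<close>

locale power_law_basis =
  fixes \<alpha> \<beta> C :: real
    and \<phi> :: "int ^ 'd::finite \<Rightarrow> (int ^ 'd) ell2"
    and j :: "int ^ 'd \<Rightarrow> int ^ 'd"
  assumes \<beta>: "0 \<le> \<beta>" and C: "0 < C" and \<alpha>: "\<beta> + real CARD('d) / 2 < \<alpha>"
    and basis: "orthonormal_basis \<phi>"
    and decay: "cmod (coord (\<phi> m) n) \<le> C * (bracket (j m) powr \<beta> / bracket (n - j m) powr \<alpha>)"
begin

abbreviation sites :: "real \<Rightarrow> (int ^ 'd) set" where
  "sites L \<equiv> {m. bracket (j m) \<le> L}"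

lemma decay_square:
  "(cmod (coord (\<phi> m) n))\<^sup>2 \<le> C\<^sup>2 * bracket (j m) powr (2 * \<beta>) * bracket (n - j m) powr - (2 * \<alpha>)"
proof -
  have "(cmod (coord (\<phi> m) n))\<^sup>2 \<le> (C * (bracket (j m) powr \<beta> / bracket (n - j m) powr \<alpha>))\<^sup>2"
    by (intro power_mono decay) simp
  then show ?thesis
    by (simp add: power_mult_distrib power_divide powr_square powr_minus_divide)
qed

lemma has_sum_coord: "((\<lambda>n. (cmod (coord (\<phi> m) n))\<^sup>2) has_sum 1) UNIV"
proof -
  have "norm (\<phi> m) = 1"
    using basis by (simp add: orthonormal_basis_def norm_eq_sqrt_inner inner_ell2_def)
  then show ?thesis using has_sum_norm_ell2[of "\<phi> m"] by simp
qed

lemma sum_coord_le_1: "finite F \<Longrightarrow> (\<Sum>n\<in>F. (cmod (coord (\<phi> m) n))\<^sup>2) \<le> 1"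
  by (rule finite_sum_le_has_sum[OF has_sum_coord]) auto

lemma sum_basis_le_1: "finite F \<Longrightarrow> (\<Sum>m\<in>F. (cmod (coord (\<phi> m) n))\<^sup>2) \<le> 1"
  by (rule finite_sum_le_has_sum[OF has_sum_basis_coord[OF basis]]) auto

text \<open>The surplus \<open>2 * \<alpha> - 2 * \<beta> - d > 0\<close> is split: \<open>\<sigma> > d\<close> is spent on summability over the lattice
  and \<open>\<kappa> > 0\<close> remains as a rate of decay in \<open>L\<close>.\<close>

definition \<kappa> :: real where "\<kappa> = (2 * \<alpha> - 2 * \<beta> - real CARD('d)) / 2"
definition \<sigma> :: real where "\<sigma> = 2 * \<alpha> - 2 * \<beta> - \<kappa>"

lemma \<kappa>_pos: "0 < \<kappa>" and \<sigma>_gt: "real CARD('d) < \<sigma>"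
  using \<alpha> by (simp_all add: \<kappa>_def \<sigma>_def field_simps)

text \<open>Mass in the enlarged box is counted twice: each eigenfunction in \<open>F\<close>
  contributes almost 1, and each site receives at most 1. The finite subset \<open>F\<close> stands
  in for \<open>sites L\<close>, whose finiteness is deduced from this very bound.\<close>

lemma card_sites_le_aux:
  assumes "0 < \<eta>"
  obtains c where "0 \<le> c"
    "\<And>L F. 1 \<le> L \<Longrightarrow> finite F \<Longrightarrow> F \<subseteq> sites L \<Longrightarrow>
       real (card F) * (1 - c * L powr - \<kappa>) \<le> (2 * ((1 + \<eta>) * L)) ^ CARD('d)"
proof -
  obtain Z where Z: "0 \<le> Z" "\<And>F (a :: int ^ 'd). finite F \<Longrightarrow> (\<Sum>n\<in>F. bracket (n - a) powr - \<sigma>) \<le> Z"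
    using sum_bracket_powr_bounded[OF \<sigma>_gt] by blast
  define c where "c = C\<^sup>2 * \<eta> powr - (2 * \<beta> + \<kappa>) * Z"
  show ?thesis
  proof
    show "0 \<le> c" using Z by (simp add: c_def)
    fix L F assume L: "1 \<le> L" and F: "finite F" "F \<subseteq> sites L"
    let ?B = "{n :: int ^ 'd. bracket n \<le> (1 + \<eta>) * L}"
    have mass: "1 - c * L powr - \<kappa> \<le> (\<Sum>n\<in>?B. (cmod (coord (\<phi> m) n))\<^sup>2)" if "m \<in> F" for m
    proof (rule has_sum_diff_le_finite_sum[OF has_sum_coord _ finite_bracket_ball])
      have jm: "bracket (j m) \<le> L" using that F by auto
      fix G :: "(int ^ 'd) set" assume G: "finite G" "G \<inter> ?B = {}"
      have "(\<Sum>n\<in>G. (cmod (coord (\<phi> m) n))\<^sup>2)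
          \<le> (\<Sum>n\<in>G. C\<^sup>2 * L powr (2 * \<beta>) * (\<eta> * L) powr - (2 * \<beta> + \<kappa>) * bracket (n - j m) powr - \<sigma>)"
      proof (rule sum_mono)
        fix n assume "n \<in> G"
        then have "(1 + \<eta>) * L < bracket n" using G by auto
        then have far: "\<eta> * L \<le> bracket (n - j m)"
          using bracket_le_add[of n "j m"] jm by (simp add: algebra_simps)
        have "(cmod (coord (\<phi> m) n))\<^sup>2
            \<le> C\<^sup>2 * bracket (j m) powr (2 * \<beta>) * bracket (n - j m) powr - (2 * \<alpha>)" by (rule decay_square)
        \<comment> \<open>The first factor beats the growth \<open>L powr (2 * \<beta>)\<close> and
          leaves \<open>L powr - \<kappa>\<close>; the second is summable over the lattice.\<close>
        also have "bracket (n - j m) powr - (2 * \<alpha>)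
            = bracket (n - j m) powr - (2 * \<beta> + \<kappa>) * bracket (n - j m) powr - \<sigma>"
          by (simp add: \<sigma>_def flip: powr_add)
        also have "C\<^sup>2 * bracket (j m) powr (2 * \<beta>) * \<dots>
            \<le> C\<^sup>2 * L powr (2 * \<beta>) * ((\<eta> * L) powr - (2 * \<beta> + \<kappa>) * bracket (n - j m) powr - \<sigma>)"
          using jm far \<beta> \<kappa>_pos assms L bracket_pos[of "j m"]
          by (intro mult_mono[OF mult_left_mono[OF powr_mono2] mult_right_mono[OF powr_mono2']]) auto
        finally show "(cmod (coord (\<phi> m) n))\<^sup>2
            \<le> C\<^sup>2 * L powr (2 * \<beta>) * (\<eta> * L) powr - (2 * \<beta> + \<kappa>) * bracket (n - j m) powr - \<sigma>"
          by (simp add: mult_ac)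
      qed
      also have "\<dots> \<le> C\<^sup>2 * L powr (2 * \<beta>) * (\<eta> * L) powr - (2 * \<beta> + \<kappa>) * Z"
        unfolding sum_distrib_left[symmetric] using Z(2)[OF G(1)] by (intro mult_left_mono) auto
      also have "\<dots> = c * (L powr (2 * \<beta>) * L powr - (2 * \<beta> + \<kappa>))"
        using assms L by (simp add: c_def powr_mult)
      also have "L powr (2 * \<beta>) * L powr - (2 * \<beta> + \<kappa>) = L powr - \<kappa>"
        by (simp flip: powr_add)
      finally show "(\<Sum>n\<in>G. (cmod (coord (\<phi> m) n))\<^sup>2) \<le> c * L powr - \<kappa>" .
    qed simp
    have "real (card F) * (1 - c * L powr - \<kappa>) = (\<Sum>m\<in>F. 1 - c * L powr - \<kappa>)" by simp
    also have "\<dots> \<le> (\<Sum>m\<in>F. \<Sum>n\<in>?B. (cmod (coord (\<phi> m) n))\<^sup>2)" by (intro sum_mono mass)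
    also have "\<dots> = (\<Sum>n\<in>?B. \<Sum>m\<in>F. (cmod (coord (\<phi> m) n))\<^sup>2)" by (rule sum.swap)
    also have "\<dots> \<le> (\<Sum>n\<in>?B. 1)" by (intro sum_mono sum_basis_le_1 F)
    also have "\<dots> \<le> (2 * ((1 + \<eta>) * L)) ^ CARD('d)"
      using card_bracket_ball_le[where 'd = 'd, of "(1 + \<eta>) * L"] assms L by simp
    finally show "real (card F) * (1 - c * L powr - \<kappa>) \<le> (2 * ((1 + \<eta>) * L)) ^ CARD('d)" .
  qed
qed

lemma tendsto_powr_\<kappa>: "((\<lambda>L. c * L powr - \<kappa>) \<longlongrightarrow> 0) at_top"
  using tendsto_mult[OF tendsto_const tendsto_neg_powr[OF _ filterlim_ident], of "- \<kappa>" c] \<kappa>_pos by simp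

lemma card_sites_polynomial:
  obtains K where "\<And>L. 1 \<le> L \<Longrightarrow> finite (sites L) \<and> real (card (sites L)) \<le> K * L powr real CARD('d)"
proof -
  obtain c where c: "0 \<le> c"
    "\<And>L F. 1 \<le> L \<Longrightarrow> finite F \<Longrightarrow> F \<subseteq> sites L \<Longrightarrow>
       real (card F) * (1 - c * L powr - \<kappa>) \<le> (2 * ((1 + 1) * L)) ^ CARD('d)"
    using card_sites_le_aux[of 1] by (metis zero_less_one)
  have "\<forall>\<^sub>F L in at_top. c * L powr - \<kappa> < 1 / 2"
    using tendsto_powr_\<kappa>[of c] by (rule order_tendstoD) simp
  then obtain L0 where L0: "\<And>L. L \<ge> L0 \<Longrightarrow> c * L powr - \<kappa> < 1 / 2"
    by (auto simp: eventually_at_top_linorder)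
  \<comment> \<open>Counting at the radius \<open>L1 * L\<close>, which lies beyond the threshold
    \<open>L0\<close> for every \<open>L \<ge> 1\<close>, gives a bound valid from 1 onwards rather
    than only eventually. The cost is a constant factor.\<close>
  define L1 where "L1 = max 1 L0"
  show ?thesis
  proof
    fix L :: real assume L: "1 \<le> L"
    have L1: "1 \<le> L1 * L" "L \<le> L1 * L" "L0 \<le> L1 * L"
    proof -
      have "1 \<le> L1" "L0 \<le> L1" by (simp_all add: L1_def)
      moreover from this have "1 * L \<le> L1 * L" "L1 * 1 \<le> L1 * L"
        using L by (auto intro!: mult_right_mono mult_left_mono)
      ultimately show "1 \<le> L1 * L" "L \<le> L1 * L" "L0 \<le> L1 * L" using L by linarith+
    qed
    define M where "M = 2 * (4 * (L1 * L)) ^ CARD('d)"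
    have bound: "real (card F) \<le> M" if F: "F \<subseteq> sites L" "finite F" for F
    proof -
      have "real (card F) * (1 / 2) \<le> real (card F) * (1 - c * (L1 * L) powr - \<kappa>)"
        using L0[OF L1(3)] by (intro mult_left_mono) auto
      also have "\<dots> \<le> (2 * ((1 + 1) * (L1 * L))) ^ CARD('d)"
        using F L1 by (intro c(2)) auto
      finally show ?thesis by (simp add: M_def mult.assoc[symmetric])
    qed
    have "finite (sites L) \<and> card (sites L) \<le> nat \<lfloor>M\<rfloor>"
      by (rule finite_if_finite_subsets_card_bdd) (use bound in \<open>auto simp: le_nat_floor\<close>)
    then show "finite (sites L) \<and> real (card (sites L)) \<le> (2 * (4 * L1) ^ CARD('d)) * L powr real CARD('d)"
      using bound[of "sites L"] L by (simp add: M_def powr_realpow power_mult_distrib mult_ac)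
  qed
qed

lemma finite_sites: "1 \<le> L \<Longrightarrow> finite (sites L)"
  using card_sites_polynomial by blast

lemma sum_center_powr_bounded:
  assumes "real CARD('d) < s"
  obtains S where "0 \<le> S" "\<And>F. finite F \<Longrightarrow> (\<Sum>m\<in>F. bracket (j m) powr - s) \<le> S"
proof -
  obtain K where "\<And>L. 1 \<le> L \<Longrightarrow> finite (sites L) \<and> real (card (sites L)) \<le> K * L powr real CARD('d)"
    using card_sites_polynomial by blast
  then show ?thesis
    using sum_powr_bounded_of_card_le[of "\<lambda>m. bracket (j m)" K "real CARD('d)" s] that assms
    by (auto simp: bracket_ge_1)
qed

text \<open>The dual count: each site of the smaller box receives almost all its mass from
  \<open>sites L\<close>, and each eigenfunction can give at most 1. The tail is now summed over
  centers, through the convergence that the upper count provides.\<close>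

lemma card_sites_ge_aux:
  assumes "0 < \<eta>" "\<eta> < 1"
  obtains c where "0 \<le> c"
    "\<And>L. 1 \<le> L \<Longrightarrow> real (card {n :: int ^ 'd. bracket n \<le> (1 - \<eta>) * L}) * (1 - c * L powr - \<kappa>)
       \<le> real (card (sites L))"
proof -
  obtain S where S: "0 \<le> S" "\<And>F. finite F \<Longrightarrow> (\<Sum>m\<in>F. bracket (j m) powr - \<sigma>) \<le> S"
    using sum_center_powr_bounded[OF \<sigma>_gt] by blast
  define c where "c = C\<^sup>2 * \<eta> powr - (2 * \<alpha>) * S"
  show ?thesis
  proof
    show "0 \<le> c" using S by (simp add: c_def)
    fix L :: real assume L: "1 \<le> L"
    let ?B = "{n :: int ^ 'd. bracket n \<le> (1 - \<eta>) * L}"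
    have mass: "1 - c * L powr - \<kappa> \<le> (\<Sum>m\<in>sites L. (cmod (coord (\<phi> m) n))\<^sup>2)" if n: "n \<in> ?B" for n
    proof (rule has_sum_diff_le_finite_sum[OF has_sum_basis_coord[OF basis] _ finite_sites[OF L]])
      fix G :: "(int ^ 'd) set" assume G: "finite G" "G \<inter> sites L = {}"
      have "(\<Sum>m\<in>G. (cmod (coord (\<phi> m) n))\<^sup>2)
          \<le> (\<Sum>m\<in>G. C\<^sup>2 * \<eta> powr - (2 * \<alpha>) * L powr - \<kappa> * bracket (j m) powr - \<sigma>)"
      proof (rule sum_mono)
        fix m assume "m \<in> G"
        then have jm: "L < bracket (j m)" using G by auto
        \<comment> \<open>Measuring the box against the center itself instead of \<open>L\<close>
          makes the distance comparable to \<open>bracket (j m)\<close>, so the decay absorbs the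
          factor \<open>bracket (j m) powr (2 * \<beta>)\<close> however far away the center
          is.\<close>
        have "bracket n \<le> (1 - \<eta>) * bracket (j m)"
          using n jm assms by (auto intro: order_trans mult_left_mono)
        then have far: "\<eta> * bracket (j m) \<le> bracket (n - j m)"
          using bracket_le_add[of "j m" n] by (simp add: bracket_minus_commute algebra_simps)
        have "(cmod (coord (\<phi> m) n))\<^sup>2
            \<le> C\<^sup>2 * bracket (j m) powr (2 * \<beta>) * bracket (n - j m) powr - (2 * \<alpha>)" by (rule decay_square)
        also have "\<dots> \<le> C\<^sup>2 * bracket (j m) powr (2 * \<beta>) * (\<eta> * bracket (j m)) powr - (2 * \<alpha>)"
          using far assms bracket_pos[of "j m"] \<alpha> \<beta> by (intro mult_left_mono powr_mono2') auto
        also have "\<dots> = C\<^sup>2 * \<eta> powr - (2 * \<alpha>) * (bracket (j m) powr - \<kappa> * bracket (j m) powr - \<sigma>)"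
          using assms bracket_pos[of "j m"]
          by (simp add: powr_mult \<sigma>_def flip: powr_add)
        also have "\<dots> \<le> C\<^sup>2 * \<eta> powr - (2 * \<alpha>) * (L powr - \<kappa> * bracket (j m) powr - \<sigma>)"
          using jm L \<kappa>_pos by (intro mult_left_mono mult_right_mono powr_mono2') auto
        finally show "(cmod (coord (\<phi> m) n))\<^sup>2
            \<le> C\<^sup>2 * \<eta> powr - (2 * \<alpha>) * L powr - \<kappa> * bracket (j m) powr - \<sigma>"
          by (simp add: mult_ac)
      qed
      also have "\<dots> \<le> C\<^sup>2 * \<eta> powr - (2 * \<alpha>) * L powr - \<kappa> * S"
        unfolding sum_distrib_left[symmetric] using S(2)[OF G(1)] by (intro mult_left_mono) auto
      finally show "(\<Sum>m\<in>G. (cmod (coord (\<phi> m) n))\<^sup>2) \<le> c * L powr - \<kappa>"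
        by (simp add: c_def mult_ac)
    qed simp
    have "real (card ?B) * (1 - c * L powr - \<kappa>) = (\<Sum>n\<in>?B. 1 - c * L powr - \<kappa>)" by simp
    also have "\<dots> \<le> (\<Sum>n\<in>?B. \<Sum>m\<in>sites L. (cmod (coord (\<phi> m) n))\<^sup>2)" by (intro sum_mono mass)
    also have "\<dots> = (\<Sum>m\<in>sites L. \<Sum>n\<in>?B. (cmod (coord (\<phi> m) n))\<^sup>2)" by (rule sum.swap)
    also have "\<dots> \<le> (\<Sum>m\<in>sites L. 1)" by (intro sum_mono sum_coord_le_1 finite_bracket_ball)
    finally show "real (card ?B) * (1 - c * L powr - \<kappa>) \<le> real (card (sites L))" by simp
  qed
qed

lemma density_tendsto_1: "((\<lambda>L. real (card (sites L)) / (2 * L + 1) ^ CARD('d)) \<longlongrightarrow> 1) at_top"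
proof (rule order_tendstoI)
  fix a :: real assume "1 < a"
  have "((\<lambda>\<eta>::real. (1 + \<eta>) ^ CARD('d)) \<longlongrightarrow> (1 + 0) ^ CARD('d)) (at_right 0)" by (intro tendsto_intros)
  then have "\<forall>\<^sub>F \<eta>::real in at_right 0. (1 + \<eta>) ^ CARD('d) < a"
    using \<open>1 < a\<close> by (intro order_tendstoD) auto
  then have "\<forall>\<^sub>F \<eta>::real in at_right 0. (1 + \<eta>) ^ CARD('d) < a \<and> 0 < \<eta>"
    by (intro eventually_conj eventually_at_right_less)
  then obtain \<eta> :: real where \<eta>: "(1 + \<eta>) ^ CARD('d) < a" "0 < \<eta>"
    using eventually_happens'[OF trivial_limit_at_right_real] by blast
  obtain c where c: "0 \<le> c"
    "\<And>L F. 1 \<le> L \<Longrightarrow> finite F \<Longrightarrow> F \<subseteq> sites L \<Longrightarrow>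
       real (card F) * (1 - c * L powr - \<kappa>) \<le> (2 * ((1 + \<eta>) * L)) ^ CARD('d)"
    using card_sites_le_aux[OF \<eta>(2)] by blast
  have "((\<lambda>L. (1 + \<eta>) ^ CARD('d) / (1 - c * L powr - \<kappa>)) \<longlongrightarrow> (1 + \<eta>) ^ CARD('d) / (1 - 0)) at_top"
    by (intro tendsto_intros tendsto_powr_\<kappa>) simp
  then have "\<forall>\<^sub>F L in at_top. (1 + \<eta>) ^ CARD('d) / (1 - c * L powr - \<kappa>) < a"
    using \<eta> by (intro order_tendstoD) auto
  moreover have "\<forall>\<^sub>F L in at_top. c * L powr - \<kappa> < 1"
    by (rule order_tendstoD[OF tendsto_powr_\<kappa>]) simp
  ultimately show "\<forall>\<^sub>F L in at_top. real (card (sites L)) / (2 * L + 1) ^ CARD('d) < a"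
    using eventually_ge_at_top[of 1]
  proof eventually_elim
    case (elim L)
    have "real (card (sites L)) * (1 - c * L powr - \<kappa>) \<le> (2 * ((1 + \<eta>) * L)) ^ CARD('d)"
      using elim by (intro c finite_sites) auto
    also have "\<dots> \<le> ((1 + \<eta>) * (2 * L + 1)) ^ CARD('d)"
      using elim \<eta> by (intro power_mono) (auto simp: algebra_simps)
    finally have "real (card (sites L)) / (2 * L + 1) ^ CARD('d) \<le> (1 + \<eta>) ^ CARD('d) / (1 - c * L powr - \<kappa>)"
      using elim by (simp add: power_mult_distrib divide_le_eq le_divide_eq mult_ac)
    then show ?case using elim by simp
  qed
next
  fix a :: real assume "a < 1"
  \<comment> \<open>The factor 1 - 2 \<eta> instead of 1 - \<eta> leaves a slack of 2 \<eta> L. For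
    L \<ge> 2 / \<eta> this is at least 4, enough for the boundary terms in (1 - 2 \<eta>) (2 L + 1)
    \<le> 2 (1 - \<eta>) L - 3.\<close>
  have "((\<lambda>\<eta>::real. (1 - 2 * \<eta>) ^ CARD('d)) \<longlongrightarrow> (1 - 2 * 0) ^ CARD('d)) (at_right 0)" by (intro tendsto_intros)
  then have "\<forall>\<^sub>F \<eta>::real in at_right 0. a < (1 - 2 * \<eta>) ^ CARD('d)"
    using \<open>a < 1\<close> by (intro order_tendstoD) auto
  then have "\<forall>\<^sub>F \<eta>::real in at_right 0. a < (1 - 2 * \<eta>) ^ CARD('d) \<and> \<eta> \<in> {0<..<1/2}"
    by (intro eventually_conj eventually_at_right_real) auto
  then obtain \<eta> :: real where \<eta>: "a < (1 - 2 * \<eta>) ^ CARD('d)" "0 < \<eta>" "\<eta> < 1 / 2"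
    using eventually_happens'[OF trivial_limit_at_right_real] by auto
  obtain c where c: "0 \<le> c"
    "\<And>L. 1 \<le> L \<Longrightarrow> real (card {n :: int ^ 'd. bracket n \<le> (1 - \<eta>) * L}) * (1 - c * L powr - \<kappa>)
       \<le> real (card (sites L))"
    using card_sites_ge_aux[of \<eta>] \<eta> by auto
  have "((\<lambda>L. (1 - 2 * \<eta>) ^ CARD('d) * (1 - c * L powr - \<kappa>)) \<longlongrightarrow> (1 - 2 * \<eta>) ^ CARD('d) * (1 - 0)) at_top"
    by (intro tendsto_intros tendsto_powr_\<kappa>)
  then have "\<forall>\<^sub>F L in at_top. a < (1 - 2 * \<eta>) ^ CARD('d) * (1 - c * L powr - \<kappa>)"
    using \<eta> by (intro order_tendstoD) auto
  moreover have "\<forall>\<^sub>F L in at_top. c * L powr - \<kappa> < 1"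
    by (rule order_tendstoD[OF tendsto_powr_\<kappa>]) simp
  ultimately show "\<forall>\<^sub>F L in at_top. a < real (card (sites L)) / (2 * L + 1) ^ CARD('d)"
    using eventually_ge_at_top[of "max 1 (2 / \<eta>)"]
  proof eventually_elim
    case (elim L)
    have L: "1 \<le> L" "2 \<le> \<eta> * L"
      using elim(3) \<eta>(2) by (simp_all add: divide_le_eq mult.commute)
    have "0 \<le> (1 - 2 * \<eta>) * (2 * L + 1)" using \<eta> L by simp
    moreover have "(1 - 2 * \<eta>) * (2 * L + 1) \<le> 2 * ((1 - \<eta>) * L) - 3" using \<eta> L by (simp add: algebra_simps)
    ultimately have "((1 - 2 * \<eta>) * (2 * L + 1)) ^ CARD('d) \<le> (2 * ((1 - \<eta>) * L) - 3) ^ CARD('d)"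
      and "2 * ((1 - \<eta>) * L) \<ge> 3"
      by (auto intro: power_mono)
    then have "((1 - 2 * \<eta>) * (2 * L + 1)) ^ CARD('d) * (1 - c * L powr - \<kappa>)
        \<le> real (card {n :: int ^ 'd. bracket n \<le> (1 - \<eta>) * L}) * (1 - c * L powr - \<kappa>)"
      using elim by (intro mult_right_mono order_trans[OF _ card_bracket_ball_ge]) auto
    also have "\<dots> \<le> real (card (sites L))" using L(1) by (rule c(2))
    finally have "(1 - 2 * \<eta>) ^ CARD('d) * (1 - c * L powr - \<kappa>) \<le> real (card (sites L)) / (2 * L + 1) ^ CARD('d)"
      using L by (simp add: power_mult_distrib le_divide_eq mult_ac)
    then show ?case using elim by simp
  qed
qed

section \<open>The eigenfunction correlator\<close>

lemma eigenfunction_correlator_sum_le: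
  assumes "0 < \<epsilon>"
  obtains \<gamma> where "0 < \<gamma>"
    "\<And>k n F. finite F \<Longrightarrow> (\<Sum>m\<in>F. cmod (coord (\<phi> m) k) * cmod (coord (\<phi> m) n)) \<le>
       \<gamma> * (min (bracket k) (bracket n) powr (\<beta> + real CARD('d) / 2 + \<epsilon>) /
             bracket (n - k) powr (\<alpha> - \<beta> - real CARD('d) / 2 - \<epsilon>))"
proof -
  \<comment> \<open>The exponent splits as \<alpha> = \<beta> + p + h: \<open>h\<close> is just
    large enough for the squares of \<open>bracket (j m) powr - h\<close> to be summable, and
    \<open>p\<close> is the decay exponent left for \<open>n - k\<close>.\<close>
  define h where "h = real CARD('d) / 2 + \<epsilon>"
  define p where "p = \<alpha> - \<beta> - h"
  have h: "0 < h" "real CARD('d) < 2 * h" using assms by (simp_all add: h_def)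
  obtain S where S: "0 \<le> S" "\<And>F. finite F \<Longrightarrow> (\<Sum>m\<in>F. bracket (j m) powr - (2 * h)) \<le> S"
    using sum_center_powr_bounded[OF h(2)] by blast
  \<comment> \<open>The summand 1 serves the case \<open>p < 0\<close>: the right-hand side is then
    at least 1, which bounds the correlator by Parseval's identity alone.\<close>
  define \<gamma> where "\<gamma> = 1 + C * 2 powr p * (S + 1)"
  have \<gamma>: "1 \<le> \<gamma>" "C * 2 powr p * (S + 1) \<le> \<gamma>" using C S by (simp_all add: \<gamma>_def)
  have *: "(\<Sum>m\<in>F. cmod (coord (\<phi> m) k) * cmod (coord (\<phi> m) n)) \<le>
       \<gamma> * (min (bracket k) (bracket n) powr (\<beta> + h) * bracket (n - k) powr - p)" if F: "finite F" for k n F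
  proof -
    define a where "a m = cmod (coord (\<phi> m) k)" for m
    define b where "b m = cmod (coord (\<phi> m) n)" for m
    define M where "M = min (bracket k) (bracket n)"
    define r where "r = bracket (n - k)"
    have nn: "0 \<le> a m" "0 \<le> b m" for m by (simp_all add: a_def b_def)
    have sq: "(\<Sum>m\<in>F. (a m)\<^sup>2) \<le> 1" "(\<Sum>m\<in>F. (b m)\<^sup>2) \<le> 1"
      using sum_basis_le_1[OF F] by (simp_all add: a_def b_def)
    have M: "1 \<le> M" and r: "1 \<le> r" using bracket_ge_1 by (auto simp: M_def r_def)
    have amgm: "x * y \<le> (x\<^sup>2 + y\<^sup>2) / 2" for x y :: real
      using zero_le_power2[of "x - y"] by (simp add: power2_diff)
    show ?thesis
    proof (cases "0 \<le> p")
      case False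
      have "1 * (1 * 1) \<le> \<gamma> * (M powr (\<beta> + h) * r powr - p)"
        using \<gamma>(1) M r h \<beta> False by (intro mult_mono ge_one_powr_ge_zero) auto
      then have ge: "1 \<le> \<gamma> * (M powr (\<beta> + h) * r powr - p)" by simp
      have "(\<Sum>m\<in>F. a m * b m) \<le> (\<Sum>m\<in>F. ((a m)\<^sup>2 + (b m)\<^sup>2) / 2)" by (intro sum_mono amgm)
      also have "\<dots> \<le> 1" unfolding sum_divide_distrib[symmetric] sum.distrib using sq by simp
      also note ge
      finally show ?thesis by (simp add: a_def b_def M_def r_def)
    next
      case True
      define T where "T = C * 2 powr p * (M powr (\<beta> + h) * r powr - p)"
      have T: "0 \<le> T" using C by (simp add: T_def)
      have min_le: "min (a m) (b m) \<le> T * bracket (j m) powr - h" for m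
      proof -
        define x where "x = max (bracket (k - j m)) (bracket (n - j m))"
        have x: "1 \<le> x" using bracket_ge_1 by (auto simp: x_def le_max_iff_disj)
        have jx: "bracket (j m) \<le> M * x"
        proof -
          have "bracket (j m) \<le> bracket i * bracket (i - j m)" for i
            using bracket_le_mult[of "j m" i] by (simp add: bracket_minus_commute)
          moreover have "bracket i * bracket (i - j m) \<le> bracket i * x" if "i \<in> {k, n}" for i
            using that bracket_pos[of i] by (intro mult_left_mono) (auto simp: x_def)
          ultimately show ?thesis unfolding M_def min_def by (smt (verit) insertCI)
        qed
        have rx: "r / 2 \<le> x"
          using bracket_le_add[of "n - k" "j m - k"] bracket_minus_commute[of k "j m"]
          by (simp add: r_def x_def)
        have "min (a m) (b m) \<le> C * (bracket (j m) powr \<beta> / x powr \<alpha>)"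
          using decay[of m k] decay[of m n] by (simp add: a_def b_def x_def max_def min_def)
        \<comment> \<open>Each power of \<open>x\<close> has its own task:
          \<open>x powr - \<beta>\<close> cancels the growth in the center,
          \<open>x powr - p\<close> becomes decay in \<open>r\<close>, and \<open>x powr - h\<close>
          is traded for \<open>bracket (j m) powr - h\<close> at the price
          \<open>M powr h\<close>.\<close>
        also have "\<dots> = C * (bracket (j m) powr \<beta> * (x powr - \<beta> * (x powr - p * x powr - h)))"
        proof -
          have "x powr - \<beta> * (x powr - p * x powr - h) = x powr - \<alpha>"
            by (simp add: p_def flip: powr_add)
          then show ?thesis by (simp only: powr_minus divide_inverse)
        qed
        also have "\<dots> \<le> C * ((M * x) powr \<beta> * (x powr - \<beta> * ((r / 2) powr - p * (bracket (j m) / M) powr - h)))"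
        proof -
          have "bracket (j m) powr \<beta> \<le> (M * x) powr \<beta>"
            using jx \<beta> bracket_pos[of "j m"] by (intro powr_mono2) auto
          moreover have "x powr - p \<le> (r / 2) powr - p"
            using rx r True by (intro powr_mono2') auto
          moreover have "x powr - h \<le> (bracket (j m) / M) powr - h"
            using jx M h bracket_pos[of "j m"] by (intro powr_mono2') (auto simp: divide_le_eq mult.commute)
          ultimately show ?thesis using C by (intro mult_left_mono mult_mono) auto
        qed
        also have "\<dots> = C * ((M * x) powr \<beta> * x powr - \<beta>) * ((r / 2) powr - p * (bracket (j m) / M) powr - h)"
          by (simp only: mult.assoc)
        also have "(M * x) powr \<beta> * x powr - \<beta> = M powr \<beta>"
          using M x by (simp add: powr_mult powr_minus)
        also have "(r / 2) powr - p = 2 powr p * r powr - p"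
          using r by (simp add: powr_divide powr_minus_divide)
        also have "(bracket (j m) / M) powr - h = M powr h * bracket (j m) powr - h"
          using M bracket_pos[of "j m"] by (simp add: powr_divide powr_minus_divide)
        also have "C * M powr \<beta> * (2 powr p * r powr - p * (M powr h * bracket (j m) powr - h))
            = T * bracket (j m) powr - h"
          by (simp add: T_def powr_add mult_ac)
        finally show ?thesis .
      qed
      \<comment> \<open>The minimum is bounded by \<open>min_le\<close> and the maximum by
        \<open>a m + b m\<close>. The inequality between arithmetic and geometric means then
        separates the factors into squares, each with a bounded sum over \<open>m\<close>.\<close>
      have "(\<Sum>m\<in>F. a m * b m) \<le> (\<Sum>m\<in>F. T * (bracket (j m) powr - (2 * h) + ((a m)\<^sup>2 + (b m)\<^sup>2) / 2))"
      proof (rule sum_mono)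
        fix m
        let ?g = "bracket (j m) powr - h"
        have "a m * b m = min (a m) (b m) * max (a m) (b m)" by (simp add: min_def max_def)
        also have "\<dots> \<le> (T * ?g) * (a m + b m)"
          using min_le[of m] nn[of m] T by (intro mult_mono) auto
        also have "\<dots> = T * (?g * a m + ?g * b m)" by (simp add: algebra_simps)
        also have "\<dots> \<le> T * (?g\<^sup>2 + ((a m)\<^sup>2 + (b m)\<^sup>2) / 2)"
        proof (rule mult_left_mono[OF _ T])
          have "?g * a m \<le> ?g\<^sup>2 / 2 + (a m)\<^sup>2 / 2" "?g * b m \<le> ?g\<^sup>2 / 2 + (b m)\<^sup>2 / 2"
            using amgm[of ?g] by (simp_all add: add_divide_distrib)
          then show "?g * a m + ?g * b m \<le> ?g\<^sup>2 + ((a m)\<^sup>2 + (b m)\<^sup>2) / 2"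
            unfolding add_divide_distrib by linarith
        qed
        finally show "a m * b m \<le> T * (bracket (j m) powr - (2 * h) + ((a m)\<^sup>2 + (b m)\<^sup>2) / 2)"
          by (simp add: powr_square)
      qed
      also have "\<dots> = T * ((\<Sum>m\<in>F. bracket (j m) powr - (2 * h)) + ((\<Sum>m\<in>F. (a m)\<^sup>2) + (\<Sum>m\<in>F. (b m)\<^sup>2)) / 2)"
        unfolding sum_distrib_left[symmetric] sum.distrib sum_divide_distrib[symmetric] ..
      also have "\<dots> \<le> T * (S + 1)"
      proof (rule mult_left_mono[OF _ T])
        have "((\<Sum>m\<in>F. (a m)\<^sup>2) + (\<Sum>m\<in>F. (b m)\<^sup>2)) / 2 \<le> 1" using sq by simp
        with S(2)[OF F] show "(\<Sum>m\<in>F. bracket (j m) powr - (2 * h)) +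
            ((\<Sum>m\<in>F. (a m)\<^sup>2) + (\<Sum>m\<in>F. (b m)\<^sup>2)) / 2 \<le> S + 1" by (rule add_mono)
      qed
      also have "\<dots> = C * 2 powr p * (S + 1) * (M powr (\<beta> + h) * r powr - p)" by (simp add: T_def)
      also have "\<dots> \<le> \<gamma> * (M powr (\<beta> + h) * r powr - p)" using \<gamma> by (intro mult_right_mono) auto
      finally show ?thesis by (simp add: a_def b_def M_def r_def)
    qed
  qed
  show ?thesis
  proof
    show "0 < \<gamma>" using \<gamma> by simp
    have exps: "\<beta> + real CARD('d) / 2 + \<epsilon> = \<beta> + h" "\<alpha> - \<beta> - real CARD('d) / 2 - \<epsilon> = p"
      by (simp_all add: p_def h_def)
    show "(\<Sum>m\<in>F. cmod (coord (\<phi> m) k) * cmod (coord (\<phi> m) n)) \<le>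
       \<gamma> * (min (bracket k) (bracket n) powr (\<beta> + real CARD('d) / 2 + \<epsilon>) /
             bracket (n - k) powr (\<alpha> - \<beta> - real CARD('d) / 2 - \<epsilon>))" if "finite F" for k n F
      unfolding exps using *[OF that] by (simp add: powr_minus_divide)
  qed
qed

section \<open>Moments of the time evolution\<close>

lemma moment_sum_bounded:
  assumes q: "0 < q" "q < 2 * \<alpha> - 2 * \<beta> - 2 * real CARD('d)"
  obtains B where "\<And>l t F. finite F \<Longrightarrow>
    (\<Sum>n\<in>F. bracket n powr q * (cmod (cinner (diagonal_group \<phi> l t (delta k)) (delta n)))\<^sup>2) \<le> B"
proof -
  \<comment> \<open>A quarter of the gap in the condition on \<open>q\<close>: since
    \<open>p\<close> loses \<epsilon> and is doubled by squaring, half of the gap survives in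
    \<open>2 * p - q - d\<close>.\<close>
  define \<epsilon> where "\<epsilon> = (2 * \<alpha> - 2 * \<beta> - 2 * real CARD('d) - q) / 4"
  define e where "e = \<beta> + real CARD('d) / 2 + \<epsilon>"
  define p where "p = \<alpha> - \<beta> - real CARD('d) / 2 - \<epsilon>"
  have \<epsilon>: "0 < \<epsilon>" using q by (simp add: \<epsilon>_def)
  have p: "real CARD('d) < 2 * p - q" using q by (simp add: p_def \<epsilon>_def field_simps)
  have e: "0 \<le> e" using \<beta> \<epsilon> by (simp add: e_def)
  obtain \<gamma> where \<gamma>: "0 < \<gamma>"
    "\<And>k n F. finite F \<Longrightarrow> (\<Sum>m\<in>F. cmod (coord (\<phi> m) k) * cmod (coord (\<phi> m) n)) \<le>
       \<gamma> * (min (bracket k) (bracket n) powr e / bracket (n - k) powr p)"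
    using eigenfunction_correlator_sum_le[OF \<epsilon>] unfolding e_def p_def by blast
  obtain Z where Z: "\<And>F (a :: int ^ 'd). finite F \<Longrightarrow> (\<Sum>n\<in>F. bracket (n - a) powr - (2 * p - q)) \<le> Z"
    using sum_bracket_powr_bounded[OF p] by blast
  define c where "c = bracket k powr q * (\<gamma> * bracket k powr e)\<^sup>2"
  show ?thesis
  proof
    fix l t and F :: "(int ^ 'd) set" assume F: "finite F"
    have "bracket n powr q * (cmod (cinner (diagonal_group \<phi> l t (delta k)) (delta n)))\<^sup>2
        \<le> c * bracket (n - k) powr - (2 * p - q)" for n
    proof -
      let ?f = "\<lambda>m. cmod (coord (\<phi> m) k) * cmod (coord (\<phi> m) n)"
      have bound: "sum ?f G \<le> \<gamma> * bracket k powr e * bracket (n - k) powr - p" if "finite G" for G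
      proof -
        have "sum ?f G \<le> \<gamma> * (min (bracket k) (bracket n) powr e / bracket (n - k) powr p)"
          using that by (rule \<gamma>(2))
        \<comment> \<open>The site \<open>k\<close> is fixed, so bounding the minimum by
          \<open>bracket k\<close> costs only a constant and keeps all the decay in
          \<open>n - k\<close>.\<close>
        also have "\<dots> \<le> \<gamma> * (bracket k powr e / bracket (n - k) powr p)"
          using \<gamma>(1) e bracket_pos[of k] bracket_pos[of n]
          by (intro mult_left_mono divide_right_mono powr_mono2) auto
        finally show ?thesis by (simp add: powr_minus_divide)
      qed
      have "?f summable_on UNIV"
        by (rule nonneg_bdd_above_summable_on) (auto intro!: bdd_aboveI bound)
      then have "cmod (cinner (diagonal_group \<phi> l t (delta k)) (delta n)) \<le> infsum ?f UNIV"
        and "infsum ?f UNIV \<le> \<gamma> * bracket k powr e * bracket (n - k) powr - p"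
        by (rule cmod_diagonal_group_le[OF basis], rule infsum_le_finite_sums) (rule bound)
      then have "cmod (cinner (diagonal_group \<phi> l t (delta k)) (delta n))
          \<le> \<gamma> * bracket k powr e * bracket (n - k) powr - p" by (rule order_trans)
      then have "(cmod (cinner (diagonal_group \<phi> l t (delta k)) (delta n)))\<^sup>2
          \<le> (\<gamma> * bracket k powr e * bracket (n - k) powr - p)\<^sup>2"
        by (rule power_mono) simp
      moreover have "bracket n powr q \<le> (bracket k * bracket (n - k)) powr q"
        using q bracket_pos[of n] by (intro powr_mono2 bracket_le_mult) auto
      ultimately have "bracket n powr q * (cmod (cinner (diagonal_group \<phi> l t (delta k)) (delta n)))\<^sup>2
          \<le> (bracket k * bracket (n - k)) powr q * (\<gamma> * bracket k powr e * bracket (n - k) powr - p)\<^sup>2"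
        by (intro mult_mono) auto
      also have "\<dots> = c * (bracket (n - k) powr q * bracket (n - k) powr - (2 * p))"
        using bracket_pos[of k] bracket_pos[of "n - k"]
        by (simp add: c_def powr_mult power_mult_distrib powr_square mult_ac)
      also have "bracket (n - k) powr q * bracket (n - k) powr - (2 * p) = bracket (n - k) powr - (2 * p - q)"
        by (simp flip: powr_add)
      finally show ?thesis .
    qed
    then have "(\<Sum>n\<in>F. bracket n powr q * (cmod (cinner (diagonal_group \<phi> l t (delta k)) (delta n)))\<^sup>2)
        \<le> (\<Sum>n\<in>F. c * bracket (n - k) powr - (2 * p - q))" by (intro sum_mono)
    also have "\<dots> \<le> c * Z"
      unfolding sum_distrib_left[symmetric] using Z[OF F] by (intro mult_left_mono) (auto simp: c_def)
    finally show "(\<Sum>n\<in>F. bracket n powr q * (cmod (cinner (diagonal_group \<phi> l t (delta k)) (delta n)))\<^sup>2)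
        \<le> c * Z" .
  qed
qed

end

section \<open>Passage to extended nonnegative sums and conclusion\<close>

lemma infsum_ennreal_le:
  assumes "\<And>F. finite F \<Longrightarrow> (\<Sum>x\<in>F. f x) \<le> B" "\<And>x. 0 \<le> f x"
  shows "(\<Sum>\<^sub>\<infinity>x. ennreal (f x)) \<le> ennreal B"
  by (rule infsum_le_finite_sums) (use assms in \<open>auto simp: sum_ennreal ennreal_leI nonneg_summable_on_complete\<close>)

theorem theorem1p1:
  fixes \<alpha> \<beta> :: real
    and D :: "(int ^ 'd::finite) ell2 set"
    and H :: "(int ^ 'd) ell2 \<Rightarrow> (int ^ 'd) ell2"
    and \<phi> :: "int ^ 'd \<Rightarrow> (int ^ 'd) ell2"
    and j :: "int ^ 'd \<Rightarrow> int ^ 'd"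
  assumes "\<alpha> > 0" and "\<beta> \<ge> 0"
    and "linear_operator D H"
    and "power_law_SULE_with \<alpha> \<beta> D H \<phi> j"
  shows
    "(\<alpha> > \<beta> + real CARD('d) / 2 \<longrightarrow>
        ((\<forall>L::real. L \<ge> 1 \<longrightarrow> finite {m. bracket (j m) \<le> L}) \<and>
         Limsup at_top (\<lambda>L::real.
           ereal (real (card {m. bracket (j m) \<le> L}) / (2 * L + 1) ^ CARD('d))) \<le> 1) \<and>
        (\<forall>\<epsilon>>0. \<exists>\<gamma>>0. \<forall>k n.
           (\<Sum>\<^sub>\<infinity>m. ennreal (cmod (coord (\<phi> m) k) * cmod (coord (\<phi> m) n)))
             \<le> ennreal (\<gamma> * (min (bracket k) (bracket n) powr (\<beta> + real CARD('d) / 2 + \<epsilon>) /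
                               bracket (n - k) powr (\<alpha> - \<beta> - real CARD('d) / 2 - \<epsilon>)))) \<and>
        (self_adjoint D H \<and> \<alpha> > \<beta> + real CARD('d) \<longrightarrow>
           (\<forall>k q. 0 < q \<and> q < 2 * \<alpha> - 2 * \<beta> - 2 * real CARD('d) \<longrightarrow>
              (SUP t. \<Sum>\<^sub>\<infinity>n. ennreal (bracket n powr q *
                 (cmod (cinner (propagator D H t (delta k)) (delta n)))\<^sup>2)) < \<infinity>))) \<and>
     (\<alpha> > \<beta> + real CARD('d) \<longrightarrow>
        ((\<lambda>L::real. real (card {m. bracket (j m) \<le> L}) / (2 * L + 1) ^ CARD('d)) \<longlongrightarrow> 1) at_top)"
proof -
  have basis: "orthonormal_basis \<phi>" and eigen: "\<And>m. eigenfunction D H (\<phi> m)"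
    using assms(4) by (auto simp: power_law_SULE_with_def)
  obtain C' where C': "\<And>m n. cmod (coord (\<phi> m) n) \<le> C' * (bracket (j m) powr \<beta> / bracket (n - j m) powr \<alpha>)"
    using assms(4) by (auto simp: power_law_SULE_with_def)
  \<comment> \<open>The localization constant carries no sign condition, while the locale asks for a
    positive one.\<close>
  define C where "C = max C' 1"
  have decay: "cmod (coord (\<phi> m) n) \<le> C * (bracket (j m) powr \<beta> / bracket (n - j m) powr \<alpha>)" for m n
    by (rule order_trans[OF C' mult_right_mono]) (auto simp: C_def)
  have loc: "power_law_basis \<alpha> \<beta> C \<phi> j" if "\<alpha> > \<beta> + real CARD('d) / 2"
    using that basis decay assms(2) by unfold_locales (auto simp: C_def)
  have loc': "power_law_basis \<alpha> \<beta> C \<phi> j" if "\<alpha> > \<beta> + real CARD('d)"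
    using that by (intro loc) (simp add: zero_le_divide_iff less_le_trans)
  show ?thesis
  proof (intro conjI impI allI)
    assume "\<alpha> > \<beta> + real CARD('d) / 2"
    then interpret power_law_basis \<alpha> \<beta> C \<phi> j by (rule loc)
    show "finite {m. bracket (j m) \<le> L}" if "1 \<le> L" for L using that by (rule finite_sites)
    have "((\<lambda>L::real. ereal (real (card {m. bracket (j m) \<le> L}) / (2 * L + 1) ^ CARD('d))) \<longlongrightarrow> ereal 1) at_top"
      using density_tendsto_1 by (simp only: lim_ereal)
    then show "Limsup at_top (\<lambda>L::real.
        ereal (real (card {m. bracket (j m) \<le> L}) / (2 * L + 1) ^ CARD('d))) \<le> 1"
      by (subst lim_imp_Limsup) (auto simp: one_ereal_def)
    fix \<epsilon> :: real assume "\<epsilon> > 0"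
    then obtain \<gamma> where "0 < \<gamma>"
      "\<And>k n F. finite F \<Longrightarrow> (\<Sum>m\<in>F. cmod (coord (\<phi> m) k) * cmod (coord (\<phi> m) n)) \<le>
         \<gamma> * (min (bracket k) (bracket n) powr (\<beta> + real CARD('d) / 2 + \<epsilon>) /
               bracket (n - k) powr (\<alpha> - \<beta> - real CARD('d) / 2 - \<epsilon>))"
      by (rule eigenfunction_correlator_sum_le) blast
    then show "\<exists>\<gamma>>0. \<forall>k n.
        (\<Sum>\<^sub>\<infinity>m. ennreal (cmod (coord (\<phi> m) k) * cmod (coord (\<phi> m) n)))
          \<le> ennreal (\<gamma> * (min (bracket k) (bracket n) powr (\<beta> + real CARD('d) / 2 + \<epsilon>) /
                            bracket (n - k) powr (\<alpha> - \<beta> - real CARD('d) / 2 - \<epsilon>)))"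
      by (intro exI[of _ \<gamma>] conjI allI infsum_ennreal_le) auto
  next
    fix k :: "int ^ 'd" and q :: real
    assume sa: "self_adjoint D H \<and> \<alpha> > \<beta> + real CARD('d)"
      and q: "0 < q \<and> q < 2 * \<alpha> - 2 * \<beta> - 2 * real CARD('d)"
    interpret power_law_basis \<alpha> \<beta> C \<phi> j using sa by (intro loc') auto
    obtain l where "\<And>m. \<phi> m \<in> D" "\<And>m. H (\<phi> m) = complex_of_real (l m) *\<^sub>C \<phi> m"
      using self_adjoint_eigenvalues_real[OF basis _ eigen] sa by blast
    then have U: "propagator D H = diagonal_group \<phi> l"
      using sa by (intro propagator_eq_diagonal_group basis) auto
    obtain B where "\<And>l t F. finite F \<Longrightarrow>
        (\<Sum>n\<in>F. bracket n powr q * (cmod (cinner (diagonal_group \<phi> l t (delta k)) (delta n)))\<^sup>2) \<le> B"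
      using q moment_sum_bounded[of q k] by blast
    then have "(SUP t. \<Sum>\<^sub>\<infinity>n. ennreal (bracket n powr q *
        (cmod (cinner (propagator D H t (delta k)) (delta n)))\<^sup>2)) \<le> ennreal B"
      unfolding U by (intro SUP_least infsum_ennreal_le) auto
    then show "(SUP t. \<Sum>\<^sub>\<infinity>n. ennreal (bracket n powr q *
        (cmod (cinner (propagator D H t (delta k)) (delta n)))\<^sup>2)) < \<infinity>"
      by (rule order_le_less_trans) simp
  next
    assume "\<alpha> > \<beta> + real CARD('d)"
    then interpret power_law_basis \<alpha> \<beta> C \<phi> j by (rule loc')
    show "((\<lambda>L::real. real (card {m. bracket (j m) \<le> L}) / (2 * L + 1) ^ CARD('d)) \<longlongrightarrow> 1) at_top"
      by (rule density_tendsto_1)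
  qed
qed

end
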